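(* Let $c\in\mathbb{C}(t)$, $c\notin\{0,1,t\}$, with homogeneous lift $C=(c_1,c_2)$, and let $d$ and $G_C$ be as in the context. Then for all $(t_1,t_2)\in\mathbb{C}^2$ with $t_2\neq0$ and $t_1/t_2\notin\{0,1\}$, $$G_C(t_1,t_2)=\frac{2}{d}\left(|t_2|\,D(t_1/t_2)\int_{\mathbb{P}^1}\frac{\log|c_1-c_2\zeta|}{|\zeta(\zeta-1)(t_2\zeta-t_1)|}\,|d\zeta|^2+\log|t_2|\right)-\frac1d\log|\gcd(F_{t_1,t_2}(C))|,$$ where $c_1,c_2$ are evaluated at $(t_1,t_2)$ and $D(t)=4|t(t-1)|\rho_\Lambda(t)$.
   Context: Let $F_{t_1,t_2}(z,w)=\big((t_1w^2-t_2z^2)^2,\;4t_2zw(w-z)(t_1w-t_2z)\big)$. $C=(c_1,c_2)$ is a pair of coprime homogeneous polynomials in $(t_1,t_2)$ of equal degree with $c(t)=c_1(t,1)/c_2(t,1)$. $\gcd(F_{t_1,t_2}(C))$ is the gcd (a homogeneous polynomial in $(t_1,t_2)$, fixed up to scaling consistently with the definition of $F_1$) of the two coordinates of $F_{t_1,t_2}(c_1,c_2)$; $F_1=F_{t_1,t_2}(C)/\gcd(F_{t_1,t_2}(C))$, $d=\deg F_1$, $F_{n+1}=F_{t_1,t_2}(F_n)/t_2^2$, and $G_C=\lim_n\frac{1}{\deg F_n}\log\max\{|\cdot|,|\cdot|\}$ of $F_n$ on $\mathbb{C}^2\setminus\{0\}$. $|d\zeta|^2$ is Lebesgue area measure on $\mathbb{C}$.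 $\Lambda=\mathbb{C}\setminus\{0,1\}$ and $\rho_\Lambda(t)|dt|$ is the hyperbolic metric on $\Lambda$, normalized (following McMullen) so that $\frac{1}{\rho_\Lambda(t)}=2|t(t-1)|\int_{\mathbb{P}^1}\frac{|dz|^2}{|z(z-1)(z-t)|}$. *)

theory Defs
  imports "HOL-Analysis.Analysis" "HOL-Computational_Algebra.Polynomial_Factorial" "HOL-Computational_Algebra.Field_as_Ring"
begin

text \<open>A homogeneous polynomial of degree N in (t1,t2) is represented by the pair (N, p),
  where p is its dehomogenisation p(t) = P(t,1), a univariate polynomial of degree at most N.
  Thus P(t1,t2) = sum_{i<=N} coeff p i * t1^i * t2^(N-i).\<close>

type_synonym hpoly = "nat \<times> complex poly"

definition hev :: "hpoly \<Rightarrow> complex \<Rightarrow> complex \<Rightarrow> complex" where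
  "hev P t1 t2 = (\<Sum>i\<le>fst P. coeff (snd P) i * t1 ^ i * t2 ^ (fst P - i))"

definition hmul :: "hpoly \<Rightarrow> hpoly \<Rightarrow> hpoly" where
  "hmul P Q = (fst P + fst Q, snd P * snd Q)"

definition hsub :: "hpoly \<Rightarrow> hpoly \<Rightarrow> hpoly" where
  "hsub P Q = (fst P, snd P - snd Q)"

definition hsmult :: "complex \<Rightarrow> hpoly \<Rightarrow> hpoly" where
  "hsmult c P = (fst P, smult c (snd P))"

definition hT1 :: hpoly where "hT1 = (1, [:0, 1:])"
definition hT2 :: hpoly where "hT2 = (1, 1)"

definition hsq :: "hpoly \<Rightarrow> hpoly" where "hsq P = hmul P P"

text \<open>gcd of two homogeneous polynomials in (t1,t2): the power of t2 dividing both, times the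
  homogenisation of the gcd (normalised, i.e. monic) of the dehomogenisations.\<close>
definition hgcd :: "hpoly \<Rightarrow> hpoly \<Rightarrow> hpoly" where
  "hgcd P Q = (let g = gcd (snd P) (snd Q);
                   k = min (fst P - degree (snd P)) (fst Q - degree (snd Q))
               in (k + degree g, g))"

definition hdiv :: "hpoly \<Rightarrow> hpoly \<Rightarrow> hpoly" where
  "hdiv P G = (fst P - fst G, snd P div snd G)"

text \<open>C = (c1,c2) is a pair of coprime homogeneous polynomials of equal degree n (c2 nonzero,
  so that c = c1(t,1)/c2(t,1) is an element of C(t)).  Coprimality as homogeneous
  polynomials = coprime dehomogenisations and t2 not dividing both.\<close>
definition is_hom_lift :: "complex poly \<Rightarrow> complex poly \<Rightarrow> nat \<Rightarrow> bool" where
  "is_hom_lift c1 c2 n \<longleftrightarrow> c2 \<noteq> 0 \<and> degree c1 \<le> n \<and> degree c2 \<le> n \<and>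
      coprime c1 c2 \<and> (degree c1 = n \<or> degree c2 = n)"

definition Fmap :: "complex \<Rightarrow> complex \<Rightarrow> complex \<times> complex \<Rightarrow> complex \<times> complex" where
  "Fmap t1 t2 zw = (let z = fst zw; w = snd zw in
     ((t1 * w\<^sup>2 - t2 * z\<^sup>2)\<^sup>2, 4 * t2 * z * w * (w - z) * (t1 * w - t2 * z)))"

definition FmapH :: "hpoly \<times> hpoly \<Rightarrow> hpoly \<times> hpoly" where
  "FmapH ZW = (let Z = fst ZW; W = snd ZW in
     (hsq (hsub (hmul hT1 (hsq W)) (hmul hT2 (hsq Z))),
      hmul (hsmult 4 hT2) (hmul Z (hmul W (hmul (hsub W Z) (hsub (hmul hT1 W) (hmul hT2 Z)))))))"

definition FC :: "complex poly \<Rightarrow> complex poly \<Rightarrow> nat \<Rightarrow> hpoly \<times> hpoly" where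
  "FC c1 c2 n = FmapH ((n, c1), (n, c2))"

definition gcdFC :: "complex poly \<Rightarrow> complex poly \<Rightarrow> nat \<Rightarrow> hpoly" where
  "gcdFC c1 c2 n = hgcd (fst (FC c1 c2 n)) (snd (FC c1 c2 n))"

definition F1 :: "complex poly \<Rightarrow> complex poly \<Rightarrow> nat \<Rightarrow> hpoly \<times> hpoly" where
  "F1 c1 c2 n = (hdiv (fst (FC c1 c2 n)) (gcdFC c1 c2 n), hdiv (snd (FC c1 c2 n)) (gcdFC c1 c2 n))"

definition degF1 :: "complex poly \<Rightarrow> complex poly \<Rightarrow> nat \<Rightarrow> nat" where
  "degF1 c1 c2 n = fst (fst (F1 c1 c2 n))"

text \<open>Fseq k = F_{k+1}, evaluated at (t1,t2); F_{n+1} = F_{t1,t2}(F_n) / t2^2\<close>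
fun Fseq :: "complex poly \<Rightarrow> complex poly \<Rightarrow> nat \<Rightarrow> nat \<Rightarrow> complex \<Rightarrow> complex \<Rightarrow> complex \<times> complex" where
  "Fseq c1 c2 n 0 t1 t2 = (hev (fst (F1 c1 c2 n)) t1 t2, hev (snd (F1 c1 c2 n)) t1 t2)"
| "Fseq c1 c2 n (Suc k) t1 t2 =
     (let FF = Fmap t1 t2 (Fseq c1 c2 n k t1 t2) in (fst FF / t2\<^sup>2, snd FF / t2\<^sup>2))"

text \<open>degFseq k = deg F_{k+1}: applying F_{t1,t2} multiplies the degree by 4 and adds 2,
  division by t2^2 subtracts 2.\<close>
fun degFseq :: "complex poly \<Rightarrow> complex poly \<Rightarrow> nat \<Rightarrow> nat \<Rightarrow> nat" where
  "degFseq c1 c2 n 0 = degF1 c1 c2 n"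
| "degFseq c1 c2 n (Suc k) = 4 * degFseq c1 c2 n k + 2 - 2"

definition G_approx :: "complex poly \<Rightarrow> complex poly \<Rightarrow> nat \<Rightarrow> nat \<Rightarrow> complex \<Rightarrow> complex \<Rightarrow> real" where
  "G_approx c1 c2 n k t1 t2 =
     ln (max (cmod (fst (Fseq c1 c2 n k t1 t2))) (cmod (snd (Fseq c1 c2 n k t1 t2))))
       / real (degFseq c1 c2 n k)"

section \<open>Hyperbolic metric on C - {0,1}, McMullen normalisation\<close>

definition rhoLambda :: "complex \<Rightarrow> real" where
  "rhoLambda t = 1 / (2 * cmod (t * (t - 1)) *
      (LINT z|lborel. 1 / cmod (z * (z - 1) * (z - t))))"

definition Dfun :: "complex \<Rightarrow> real" where
  "Dfun t = 4 * cmod (t * (t - 1)) * rhoLambda t"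

end

theory Submission
  imports Defs "HOL-Computational_Algebra.Fundamental_Theorem_Algebra"
begin

text \<open>
  Put \<open>t = t1 / t2\<close>. Since \<open>F\<close> at \<open>(t1, t2)\<close> equals \<open>t2\<^sup>2\<close> times \<open>F\<close> at \<open>(t, 1)\<close>, the \<open>F\<^sub>n\<close> evaluated at \<open>(t1, t2)\<close> form
  an orbit of the lift of the Lattes map \<open>f(x) = (x\<^sup>2 - t)\<^sup>2 / (4 x (x - 1) (x - t))\<close>. Let \<open>m\<close> be
  the density \<open>1 / |x (x - 1) (x - t)|\<close> and \<open>U(z, w)\<close> the integral of \<open>log |z - w x| m(x)\<close>. Two facts
  identify the escape rate as \<open>U\<close> divided by the total mass of \<open>m\<close>: the difference of \<open>U\<close> and
  \<open>mass * log max(|z|, |w|)\<close> is bounded, and \<open>U \<circ> F = 4 U\<close>. For the second, change variables along \<open>f\<close>,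
  which pulls \<open>m |dx|\<^sup>2\<close> back to four times itself, on a fundamental domain of the group of
  translations by 2-torsion points \<open>s\<close>; these preserve \<open>m |dx|\<^sup>2\<close>, and
  \<open>log |P(x) - f(a) Q(x)|\<close> with \<open>f = P / Q\<close> is the sum of the \<open>log |x - s(a)|\<close>.
  No additive constant appears, because both sides vanish at the fixed point \<open>(1, 0)\<close> of \<open>F\<close>.
\<close>

section \<open>Change of variables in the complex plane\<close>

text \<open>Jacobian determinants are taken on \<open>real^2\<close>, so integrals over the plane
  are carried there by this identification and back by \<open>vecc\<close>.\<close>

definition cvec :: "real^2 \<Rightarrow> complex" where
  "cvec v = Complex (v $ 1) (v $ 2)"

definition vecc :: "complex \<Rightarrow> real^2" where
  "vecc z = vector [Re z, Im z]"

lemma cvec_vecc [simp]: "cvec (vecc z) = z"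
  by (simp add: cvec_def vecc_def)

lemma vecc_cvec [simp]: "vecc (cvec v) = v"
  by (simp add: cvec_def vecc_def vec_eq_iff forall_2)

lemma bounded_linear_cvec: "bounded_linear cvec"
  by (rule linear_conv_bounded_linear[THEN iffD1], rule linearI)
     (auto simp: cvec_def complex_eq_iff)

lemma bounded_linear_vecc: "bounded_linear vecc"
  by (rule linear_conv_bounded_linear[THEN iffD1], rule linearI)
     (auto simp: vecc_def vec_eq_iff forall_2)

lemma measurable_cvec [measurable]: "cvec \<in> borel_measurable borel"
  by (intro borel_measurable_continuous_onI linear_continuous_on bounded_linear_cvec)

text \<open>Lebesgue measure is determined by its values on boxes, and \<open>cvec\<close> pulls a
  box back to a box with the same sides.\<close>

lemma lborel_complex_eq_distr: "lborel = distr lborel borel cvec"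
proof (rule lborel_eqI)
  fix l u :: complex
  assume le: "\<And>b. b \<in> Basis \<Longrightarrow> l \<bullet> b \<le> u \<bullet> b"
  have "cvec -` box l u = box (vecc l) (vecc u)"
    by (auto simp: box_def Basis_complex_def cvec_def vecc_def Basis_vec_def inner_axis forall_2 UNIV_2)
  moreover have "emeasure lborel (box (vecc l) (vecc u)) = (\<Prod>b\<in>Basis. (vecc u - vecc l) \<bullet> b)"
    using le[of 1] le[of \<i>] by (intro emeasure_lborel_box)
      (auto simp: Basis_complex_def vecc_def Basis_vec_def inner_axis UNIV_2)
  moreover have "(\<Prod>b\<in>Basis. (vecc u - vecc l) \<bullet> b) = (\<Prod>b\<in>Basis. (u - l) \<bullet> b)"
    by (simp add: Basis_complex_def vecc_def Basis_vec_def inner_axis UNIV_2 axis_eq_axis)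
  ultimately show "emeasure (distr lborel borel cvec) (box l u) = (\<Prod>b\<in>Basis. (u - l) \<bullet> b)"
    by (simp add: emeasure_distr)
qed simp

lemma integrable_lborel_cvec:
  fixes f :: "complex \<Rightarrow> real"
  assumes [measurable]: "f \<in> borel_measurable borel"
  shows "integrable lborel (\<lambda>v. f (cvec v)) \<longleftrightarrow> integrable lborel f"
  using integrable_distr_eq[of cvec lborel borel f, unfolded lborel_complex_eq_distr[symmetric]] by simp

lemma integral_lborel_cvec:
  fixes f :: "complex \<Rightarrow> real"
  assumes [measurable]: "f \<in> borel_measurable borel"
  shows "(LINT v|lborel. f (cvec v)) = (LINT z|lborel. f z)"
  using integral_distr[of cvec lborel borel f, unfolded lborel_complex_eq_distr[symmetric]] by simp

text \<open>Multiplication by \<open>a + i b\<close> has the real matrix with rows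
  \<open>(a, -b)\<close> and \<open>(b, a)\<close>. This is the Jacobian of a holomorphic
  map.\<close>

lemma det_complex_mult:
  "det (matrix (\<lambda>v. vecc (c * cvec v))) = (cmod c)\<^sup>2"
  by (simp add: det_2 matrix_def vecc_def cvec_def axis_def cmod_power2 flip: power2_eq_square)

text \<open>The general formula concerns vector-valued integrands; a real integrand is treated as a
  vector with a single entry, which is read off at the end.\<close>

lemma absolutely_integrable_change_of_variables_vec2:
  fixes f :: "real^2 \<Rightarrow> real" and g :: "real^2 \<Rightarrow> real^2"
  assumes S: "S \<in> sets lebesgue"
    and der: "\<And>x. x \<in> S \<Longrightarrow> (g has_derivative g' x) (at x within S)"
    and inj: "inj_on g S"
    and f: "f absolutely_integrable_on (g ` S)"
  shows "(\<lambda>x. \<bar>det (matrix (g' x))\<bar> * f (g x)) absolutely_integrable_on S"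
    and "integral S (\<lambda>x. \<bar>det (matrix (g' x))\<bar> * f (g x)) = integral (g ` S) f"
proof -
  define F :: "real^2 \<Rightarrow> real^1" where "F = vec \<circ> f"
  have bl: "bounded_linear (vec :: real \<Rightarrow> real^1)"
    by (rule linear_conv_bounded_linear[THEN iffD1], rule linearI) (auto simp: vec_eq_iff)
  have bl1: "bounded_linear (\<lambda>v::real^1. v $ 1)"
    by (rule bounded_linear_vec_nth)
  have F: "F absolutely_integrable_on (g ` S)"
    unfolding F_def using f bl by (rule absolutely_integrable_linear)
  define b where "b = integral (g ` S) F"
  let ?G = "\<lambda>x. \<bar>det (matrix (g' x))\<bar> *\<^sub>R F (g x)"
  have G: "?G absolutely_integrable_on S" "integral S ?G = b"
    using has_absolute_integral_change_of_variables[OF S der inj, of F b] F b_def by auto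
  have eq: "(\<lambda>x. \<bar>det (matrix (g' x))\<bar> * f (g x)) = (\<lambda>v::real^1. v $ 1) \<circ> ?G"
    by (auto simp: F_def)
  show "(\<lambda>x. \<bar>det (matrix (g' x))\<bar> * f (g x)) absolutely_integrable_on S"
    unfolding eq using G(1) bl1 by (rule absolutely_integrable_linear)
  have "integral S ((\<lambda>v::real^1. v $ 1) \<circ> ?G) = b $ 1"
    using integral_linear[OF set_lebesgue_integral_eq_integral(1)[OF G(1)] bl1] G(2) by simp
  moreover have "integral (g ` S) ((\<lambda>v::real^1. v $ 1) \<circ> F) = b $ 1"
    using integral_linear[OF set_lebesgue_integral_eq_integral(1)[OF F] bl1] b_def by simp
  moreover have "(\<lambda>v::real^1. v $ 1) \<circ> F = f" by (auto simp: F_def)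
  ultimately show "integral S (\<lambda>x. \<bar>det (matrix (g' x))\<bar> * f (g x)) = integral (g ` S) f"
    unfolding eq by simp
qed

text \<open>The Borel hypotheses on \<open>S\<close> and its image allow the passage from integrals
  over \<open>lborel\<close> to gauge integrals on \<open>real^2\<close> and back.\<close>

lemma complex_change_of_variables:
  fixes f :: "complex \<Rightarrow> real" and g g' :: "complex \<Rightarrow> complex"
  assumes S [measurable]: "S \<in> sets borel"
    and gS [measurable]: "g ` S \<in> sets borel"
    and f [measurable]: "f \<in> borel_measurable borel"
    and g [measurable]: "g \<in> borel_measurable borel"
    and g' [measurable]: "g' \<in> borel_measurable borel"
    and der: "\<And>x. x \<in> S \<Longrightarrow> (g has_field_derivative g' x) (at x)"
    and inj: "inj_on g S"
    and int: "set_integrable lborel (g ` S) f"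
  shows "set_integrable lborel S (\<lambda>x. (cmod (g' x))\<^sup>2 * f (g x))"
    and "(LINT x:S|lborel. (cmod (g' x))\<^sup>2 * f (g x)) = (LINT x:g ` S|lborel. f x)"
proof -
  define h where "h = (\<lambda>x. (cmod (g' x))\<^sup>2 * f (g x))"
  have [measurable]: "h \<in> borel_measurable borel" unfolding h_def by measurable
  define T where "T = cvec -` S"
  define G where "G = vecc \<circ> g \<circ> cvec"
  define G' where "G' = (\<lambda>x v. vecc (g' (cvec x) * cvec v))"
  have T [measurable]: "T \<in> sets borel"
    unfolding T_def using measurable_sets[OF measurable_cvec S] by simp
  have GT: "G ` T = cvec -` (g ` S)"
  proof (intro equalityI subsetI)
    fix v assume "v \<in> cvec -` (g ` S)"
    then obtain z where "z \<in> S" "cvec v = g z" by auto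
    then have "vecc z \<in> T" "v = G (vecc z)" by (simp_all add: G_def T_def flip: \<open>cvec v = g z\<close>)
    then show "v \<in> G ` T" by blast
  qed (auto simp: G_def T_def)
  have [measurable]: "G ` T \<in> sets borel"
    unfolding GT using measurable_sets[OF measurable_cvec gS] by simp
  have derG: "(G has_derivative G' x) (at x within T)" if "x \<in> T" for x
  proof -
    have "(g has_derivative (*) (g' (cvec x))) (at (cvec x))"
      using der[of "cvec x"] that by (simp add: T_def has_field_derivative_def)
    then have "((\<lambda>y. g (cvec y)) has_derivative (\<lambda>v. g' (cvec x) * cvec v)) (at x)"
      by (rule has_derivative_compose[OF bounded_linear_imp_has_derivative[OF bounded_linear_cvec]])
    then have "((\<lambda>y. vecc (g (cvec y))) has_derivative G' x) (at x)"
      unfolding G'_def by (rule bounded_linear.has_derivative[OF bounded_linear_vecc])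
    then show ?thesis
      by (simp add: G_def o_def has_derivative_at_withinI)
  qed
  have injG: "inj_on G T"
  proof (rule inj_onI)
    fix u v assume "u \<in> T" "v \<in> T" "G u = G v"
    then have "cvec (vecc (g (cvec u))) = cvec (vecc (g (cvec v)))" "cvec u \<in> S" "cvec v \<in> S"
      by (auto simp: G_def T_def)
    then have "cvec u = cvec v" using inj_onD[OF inj] by simp
    then have "vecc (cvec u) = vecc (cvec v)" by simp
    then show "u = v" by (simp only: vecc_cvec)
  qed
  have set_cvec: "set_integrable lborel (cvec -` X) (\<lambda>v. k (cvec v)) \<longleftrightarrow> set_integrable lborel X k"
     "(LINT v:cvec -` X|lborel. k (cvec v)) = (LINT z:X|lborel. k z)"
    if [measurable]: "X \<in> sets borel" "k \<in> borel_measurable borel" for X and k :: "complex \<Rightarrow> real"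
    using integrable_lborel_cvec[of "\<lambda>x. indicator X x * k x"]
          integral_lborel_cvec[of "\<lambda>x. indicator X x * k x"]
    by (simp_all add: set_integrable_def set_lebesgue_integral_def indicator_def)
  have b1: "set_integrable lborel (G ` T) (\<lambda>v. f (cvec v))"
    unfolding GT using set_cvec(1)[OF gS f] int by simp
  \<comment> \<open>Absolute integrability refers to the completed measure; for Borel functions it
    agrees with integrability over \<open>lborel\<close>.\<close>
  have a1: "(\<lambda>v. f (cvec v)) absolutely_integrable_on G ` T"
    using b1 unfolding set_integrable_def by (subst integrable_completion) measurable
  note cov = absolutely_integrable_change_of_variables_vec2[OF _ derG injG a1]
  have det: "\<bar>det (matrix (G' x))\<bar> * f (cvec (G x)) = h (cvec x)" for x
    by (simp add: G'_def det_complex_mult G_def h_def)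
  have a2: "(\<lambda>v. h (cvec v)) absolutely_integrable_on T"
    using cov(1) by (simp add: det)
  have b2: "set_integrable lborel T (\<lambda>v. h (cvec v))"
    using a2 unfolding set_integrable_def by (subst (asm) integrable_completion) measurable
  show "set_integrable lborel S (\<lambda>x. (cmod (g' x))\<^sup>2 * f (g x))"
    using b2 set_cvec(1)[OF S, of h] by (simp add: T_def h_def)
  have "(LINT x:S|lborel. h x) = (LINT v:T|lborel. h (cvec v))"
    unfolding T_def by (rule set_cvec(2)[symmetric]) auto
  also have "\<dots> = integral T (\<lambda>v. h (cvec v))"
    by (rule set_borel_integral_eq_integral(2)[OF b2])
  also have "\<dots> = integral (G ` T) (\<lambda>v. f (cvec v))"
    using cov(2) by (simp add: det)
  also have "\<dots> = (LINT v:G ` T|lborel. f (cvec v))"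
    by (rule set_borel_integral_eq_integral(2)[OF b1, symmetric])
  also have "\<dots> = (LINT z:g ` S|lborel. f z)"
    unfolding GT by (rule set_cvec(2)) auto
  finally show "(LINT x:S|lborel. (cmod (g' x))\<^sup>2 * f (g x)) = (LINT x:g ` S|lborel. f x)"
    unfolding h_def .
qed

section \<open>Logarithmic potentials of the Legendre density\<close>

lemma integrable_lborel_shift:
  fixes f :: "complex \<Rightarrow> real" and p :: complex
  assumes f: "integrable lborel f"
  shows "integrable lborel (\<lambda>z. f (z - p))" "(LINT z|lborel. f (z - p)) = (LINT z|lborel. f z)"
proof -
  have [measurable]: "f \<in> borel_measurable borel" using f by auto
  show "integrable lborel (\<lambda>z. f (z - p))"
    using integrable_distr_eq[of "(+) (-p)" lborel borel f, unfolded lborel_distr_plus] f by simp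
  show "(LINT z|lborel. f (z - p)) = (LINT z|lborel. f z)"
    using integral_distr[of "(+) (-p)" lborel borel f, unfolded lborel_distr_plus] by simp
qed

text \<open>Takes the place of polar coordinates: \<open>h\<close> is dominated by the series of
  \<open>c k\<close> times the indicator of \<open>A k\<close>, and its integral by the sum of
  \<open>c k * e k\<close>.\<close>

lemma integrable_on_shells:
  fixes h :: "'a::euclidean_space \<Rightarrow> real" and A :: "nat \<Rightarrow> 'a set"
  assumes h [measurable]: "h \<in> borel_measurable borel" and h0: "\<And>z. 0 \<le> h z"
    and A [measurable]: "\<And>k. A k \<in> sets borel"
    and cover: "\<And>z. h z \<noteq> 0 \<Longrightarrow> \<exists>k. z \<in> A k"
    and c: "\<And>k. 0 \<le> c k" "\<And>k z. z \<in> A k \<Longrightarrow> h z \<le> c k"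
    and e: "\<And>k. 0 \<le> e k" "\<And>k. emeasure lborel (A k) \<le> ennreal (e k)"
    and sm: "summable (\<lambda>k. c k * e k)"
  shows "integrable lborel h"
proof (rule integrableI_nonneg)
  have "(\<integral>\<^sup>+ z. ennreal (h z) \<partial>lborel) \<le> (\<integral>\<^sup>+ z. (\<Sum>k. ennreal (c k) * indicator (A k) z) \<partial>lborel)"
  proof (rule nn_integral_mono)
    fix z
    show "ennreal (h z) \<le> (\<Sum>k. ennreal (c k) * indicator (A k) z)"
    proof (cases "h z = 0")
      case False
      then obtain k where k: "z \<in> A k" using cover by blast
      define F where "F = (\<lambda>i. ennreal (c i) * indicator (A i) z)"
      have "ennreal (h z) \<le> F k"
        using c(2)[OF k] k by (simp add: ennreal_leI F_def)
      also have "\<dots> \<le> (\<Sum>k. F k)"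
        using sum_le_suminf[of F "{k}"] by simp
      also have "\<dots> = (\<Sum>k. ennreal (c k) * indicator (A k) z)"
        by (simp add: F_def)
      finally show ?thesis .
    qed simp
  qed
  also have "\<dots> = (\<Sum>k. ennreal (c k) * emeasure lborel (A k))"
    by (subst nn_integral_suminf) (auto simp: nn_integral_cmult_indicator)
  also have "\<dots> \<le> (\<Sum>k. ennreal (c k * e k))"
    using c(1) e by (intro suminf_le) (auto simp: ennreal_mult intro!: mult_left_mono)
  also have "\<dots> = ennreal (\<Sum>k. c k * e k)"
    using c(1) e(1) sm by (intro suminf_ennreal2) auto
  also have "\<dots> < \<infinity>" by simp
  finally show "(\<integral>\<^sup>+ z. ennreal (h z) \<partial>lborel) < \<infinity>" .
qed (use h0 in auto)

lemma emeasure_lborel_complex_cball: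
  "0 \<le> r \<Longrightarrow> emeasure lborel (cball (c::complex) r) = ennreal (pi * r\<^sup>2)"
  by (simp add: emeasure_cball unit_ball_vol_2)

text \<open>The exponent 3/2 combines a simple pole of the density with an inverse square root that
  dominates a logarithm. It is below 2, hence integrable at 0 in the plane.\<close>

definition near_kernel :: "complex \<Rightarrow> real" where
  "near_kernel z = (if cmod z < 1 then 1 / (cmod z * sqrt (cmod z)) else 0)"

text \<open>The exponent 5/2 is the decay 3 of the density less 1/2 for the weight
  \<open>sqrt (1 + |z|)\<close>. It exceeds 2, hence is integrable at infinity.\<close>

definition far_kernel :: "complex \<Rightarrow> real" where
  "far_kernel z = (if cmod z < 1 then 0 else 1 / ((cmod z)\<^sup>2 * sqrt (cmod z)))"

lemma sqrt_four_power: "sqrt (4 ^ k) = 2 ^ k"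
  by (simp add: real_sqrt_power)

text \<open>The ratio 4 of the shells makes square roots into powers of 2. The bound
  \<open>8^(k+1)\<close> times the area \<open>pi / 16^k\<close> of the enclosing disc is a
  geometric sequence of ratio 1/2.\<close>

lemma integrable_near_kernel: "integrable lborel near_kernel"
proof (rule integrable_on_shells[where
    A = "\<lambda>k. {z. (1/4)^Suc k < cmod z \<and> cmod z \<le> (1/4)^k}" and
    c = "\<lambda>k. 8 ^ Suc k" and e = "\<lambda>k. pi * ((1/4)^k)\<^sup>2"])
  show "near_kernel \<in> borel_measurable borel" unfolding near_kernel_def by measurable
  show "{z::complex. (1/4)^Suc k < cmod z \<and> cmod z \<le> (1/4)^k} \<in> sets borel" for k by measurable
  show "\<exists>k. z \<in> {z. (1/4)^Suc k < cmod z \<and> cmod z \<le> (1/4)^k}" if "near_kernel z \<noteq> 0" for z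
  proof -
    have z: "0 < cmod z" "cmod z < 1" using that by (auto simp: near_kernel_def split: if_splits)
    define k where "k = (LEAST k. (1/4)^k < cmod z)"
    have ex: "\<exists>k. (1/4::real)^k < cmod z" using z by (intro real_arch_pow_inv) auto
    have k: "(1/4)^k < cmod z" unfolding k_def using ex by (rule LeastI_ex)
    moreover have "k \<noteq> 0" using k z by (intro notI) auto
    then obtain j where j: "k = Suc j" by (cases k) auto
    have "\<not> (1/4)^j < cmod z" using not_less_Least[of j "\<lambda>k. (1/4)^k < cmod z"] j k_def by simp
    ultimately show ?thesis using j by auto
  qed
  show "near_kernel z \<le> 8 ^ Suc k" if "z \<in> {z. (1/4)^Suc k < cmod z \<and> cmod z \<le> (1/4)^k}" for k z
  proof -
    have r: "(1/4)^Suc k < cmod z" using that by auto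
    have "(1/2)^Suc k \<le> sqrt (cmod z)"
    proof (rule real_le_rsqrt)
      show "((1/2)^Suc k)\<^sup>2 \<le> cmod z" using r
        by (simp add: power_mult_distrib power2_eq_square power_divide flip: power_mult_distrib)
    qed
    then have "(1/4)^Suc k * (1/2)^Suc k \<le> cmod z * sqrt (cmod z)"
      using r by (intro mult_mono) auto
    then have "(1/8::real)^Suc k \<le> cmod z * sqrt (cmod z)"
      by (simp flip: power_mult_distrib power_Suc)
    then have "1 / (cmod z * sqrt (cmod z)) \<le> 1 / ((1/8::real)^Suc k)"
      using r by (intro divide_left_mono mult_pos_pos) (auto intro: less_trans[rotated])
    then show ?thesis by (auto simp: near_kernel_def power_divide)
  qed
  show "emeasure lborel {z::complex. (1/4)^Suc k < cmod z \<and> cmod z \<le> (1/4)^k} \<le> ennreal (pi * ((1/4)^k)\<^sup>2)" for k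
  proof -
    have "emeasure lborel {z::complex. (1/4)^Suc k < cmod z \<and> cmod z \<le> (1/4)^k} \<le> emeasure lborel (cball (0::complex) ((1/4)^k))"
      by (intro emeasure_mono) auto
    then show ?thesis by (simp add: emeasure_lborel_complex_cball)
  qed
  have "summable (\<lambda>k. 8 * pi * (1/2)^k)"
    by (intro summable_mult summable_geometric) auto
  moreover have "8 ^ Suc k * (pi * ((1/4)^k)\<^sup>2) = 8 * pi * (1/2::real)^k" for k
    by (simp add: power2_eq_square flip: power_mult_distrib)
  ultimately show "summable (\<lambda>k. 8 ^ Suc k * (pi * ((1/4)^k)\<^sup>2))" by (simp only:)
qed (auto simp: near_kernel_def)

text \<open>Here the bound \<open>1 / 32^k\<close> meets the area \<open>16^(k+1) * pi\<close>,
  again with ratio 1/2.\<close>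

lemma integrable_far_kernel: "integrable lborel far_kernel"
proof (rule integrable_on_shells[where
    A = "\<lambda>k. {z. 4^k \<le> cmod z \<and> cmod z < 4^Suc k}" and
    c = "\<lambda>k. (1/32) ^ k" and e = "\<lambda>k. pi * (4^Suc k)\<^sup>2"])
  show "far_kernel \<in> borel_measurable borel" unfolding far_kernel_def by measurable
  show "{z::complex. 4^k \<le> cmod z \<and> cmod z < 4^Suc k} \<in> sets borel" for k by measurable
  show "\<exists>k. z \<in> {z. 4^k \<le> cmod z \<and> cmod z < 4^Suc k}" if "far_kernel z \<noteq> 0" for z
  proof -
    have z: "1 \<le> cmod z" using that by (auto simp: far_kernel_def split: if_splits)
    define k where "k = (LEAST k. cmod z < 4^k)"
    have ex: "\<exists>k. cmod z < 4^k" by (intro real_arch_pow) auto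
    have k: "cmod z < 4^k" unfolding k_def using ex by (rule LeastI_ex)
    moreover have "k \<noteq> 0" using k z by (intro notI) auto
    then obtain j where j: "k = Suc j" by (cases k) auto
    have "4^j \<le> cmod z" using not_less_Least[of j "\<lambda>k. cmod z < 4^k"] j k_def by simp
    ultimately show ?thesis using j by auto
  qed
  show "far_kernel z \<le> (1/32) ^ k" if "z \<in> {z. 4^k \<le> cmod z \<and> cmod z < 4^Suc k}" for k z
  proof -
    have r: "4^k \<le> cmod z" using that by auto
    have "2^k \<le> sqrt (cmod z)"
      using real_sqrt_le_mono[OF r] by (simp add: sqrt_four_power)
    moreover have "(4^k)\<^sup>2 \<le> (cmod z)\<^sup>2" using r by (intro power_mono) auto
    ultimately have "(4^k)\<^sup>2 * 2^k \<le> (cmod z)\<^sup>2 * sqrt (cmod z)"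
      by (intro mult_mono) auto
    then have "32^k \<le> (cmod z)\<^sup>2 * sqrt (cmod z)"
      by (simp add: power2_eq_square flip: power_mult_distrib)
    moreover have "0 < cmod z" using r by (rule less_le_trans[rotated]) simp
    ultimately have "1 / ((cmod z)\<^sup>2 * sqrt (cmod z)) \<le> 1 / 32^k"
      by (intro divide_left_mono mult_pos_pos) auto
    then show ?thesis by (auto simp: far_kernel_def power_divide)
  qed
  show "emeasure lborel {z::complex. 4^k \<le> cmod z \<and> cmod z < 4^Suc k} \<le> ennreal (pi * (4^Suc k)\<^sup>2)" for k
  proof -
    have "emeasure lborel {z::complex. 4^k \<le> cmod z \<and> cmod z < 4^Suc k} \<le> emeasure lborel (cball (0::complex) (4^Suc k))"
      by (intro emeasure_mono) auto
    then show ?thesis by (subst (asm) emeasure_lborel_complex_cball) auto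
  qed
  have "summable (\<lambda>k. 16 * pi * (1/2)^k)"
    by (intro summable_mult summable_geometric) auto
  moreover have "(1/32) ^ k * (pi * (4 ^ Suc k)\<^sup>2) = 16 * pi * (1/2::real)^k" for k
    by (simp add: power2_eq_square flip: power_mult_distrib)
  ultimately show "summable (\<lambda>k. (1/32) ^ k * (pi * (4 ^ Suc k)\<^sup>2))" by (simp only:)
qed (auto simp: far_kernel_def)

section \<open>The Legendre density and its weighted majorant\<close>

definition legendre_density :: "complex \<Rightarrow> complex \<Rightarrow> real" where
  "legendre_density t z = 1 / cmod (z * (z - 1) * (z - t))"

text \<open>The weight absorbs the growth of the logarithm at infinity, since \<open>|ln u|\<close>
  is controlled by \<open>sqrt u\<close> and its inverse.\<close>

definition weighted_density :: "complex \<Rightarrow> complex \<Rightarrow> real" where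
  "weighted_density t z = sqrt (1 + cmod z) * legendre_density t z"

lemma legendre_density_nonneg [simp]: "0 \<le> legendre_density t z"
  by (simp add: legendre_density_def)

lemma weighted_density_nonneg [simp]: "0 \<le> weighted_density t z"
  by (simp add: weighted_density_def)

lemma near_kernel_nonneg [simp]: "0 \<le> near_kernel z"
  by (simp add: near_kernel_def)

lemma far_kernel_nonneg [simp]: "0 \<le> far_kernel z"
  by (simp add: far_kernel_def)

lemma measurable_legendre_density [measurable]: "legendre_density t \<in> borel_measurable borel"
  unfolding legendre_density_def by measurable

lemma measurable_weighted_density [measurable]: "weighted_density t \<in> borel_measurable borel"
  unfolding weighted_density_def by measurable

text \<open>Partial fractions for moduli: the right-hand side is \<open>(x + y) / d\<close> times
  the left. With \<open>x\<close>, \<open>y\<close> the distances to two poles, \<open>d\<close> is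
  the distance between the poles.\<close>

lemma inverse_mult_le_sum:
  fixes x y d :: real
  assumes "0 < x" "0 < y" "0 < d" "d \<le> x + y"
  shows "1 / (x * y) \<le> (1 / d) * (1 / x + 1 / y)"
proof -
  have "1 / x + 1 / y = (x + y) * (1 / (x * y))" using assms by (simp add: field_simps)
  then have "(1 / d) * (1 / x + 1 / y) = ((x + y) / d) * (1 / (x * y))" by simp
  moreover have "1 * (1 / (x * y)) \<le> ((x + y) / d) * (1 / (x * y))"
    using assms by (intro mult_right_mono) auto
  ultimately show ?thesis by simp
qed

lemma weighted_density_le_poles:
  assumes "t \<noteq> 0" "t \<noteq> 1"
  obtains K where "0 \<le> K"
    "\<And>z. weighted_density t z \<le> K * (1 / cmod z + 1 / cmod (z - 1) + 1 / cmod (z - t))"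
proof -
  define d where "d = cmod (t - 1)"
  define e where "e = cmod t"
  have de: "0 < d" "0 < e" using assms by (auto simp: d_def e_def)
  define K where "K = 1 / e + 2 / d"
  have "weighted_density t z \<le> K * (1 / cmod z + 1 / cmod (z - 1) + 1 / cmod (z - t))" for z
  proof (cases "z \<in> {0, 1, t}")
    \<comment> \<open>At a pole the density has the value 0, by the convention
      \<open>1 / 0 = 0\<close>.\<close>
    case True
    then have "weighted_density t z = 0" by (auto simp: weighted_density_def legendre_density_def)
    then show ?thesis using de by (simp add: K_def)
  next
    case False
    define x y s where "x = cmod z" "y = cmod (z - 1)" "s = cmod (z - t)"
    have pos: "0 < x" "0 < y" "0 < s" using False by (auto simp: x_y_s_def)
    have tri: "1 \<le> x + y" "d \<le> y + s" "e \<le> x + s"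
      using norm_triangle_ineq4[of z "z - 1"] norm_triangle_ineq4[of "z - 1" "z - t"]
        norm_triangle_ineq4[of z "z - t"] by (auto simp: x_y_s_def d_def e_def)
    have ys: "1 / (y * s) \<le> (1 / d) * (1 / y + 1 / s)"
      by (rule inverse_mult_le_sum) (use pos de tri in auto)
    have xs: "1 / (x * s) \<le> (1 / e) * (1 / x + 1 / s)"
      by (rule inverse_mult_le_sum) (use pos de tri in auto)
    have "1 / (x * y) \<le> 1 * (1 / x + 1 / y)"
      using inverse_mult_le_sum[of x y 1] pos tri by simp
    then have "(1 / (x * y)) * (1 / s) \<le> (1 * (1 / x + 1 / y)) * (1 / s)"
      using pos by (intro mult_right_mono) auto
    also have "\<dots> = 1 / (x * s) + 1 / (y * s)" using pos by (simp add: field_simps)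
    finally have xys: "1 / (x * y * s) \<le> 1 / (x * s) + 1 / (y * s)" by simp
    have "weighted_density t z = sqrt (1 + x) * (1 / (x * y * s))"
      by (simp add: weighted_density_def legendre_density_def x_y_s_def norm_mult)
    \<comment> \<open>Bounding the weight by \<open>1 + x\<close> costs nothing, because the factor
      \<open>x\<close> cancels the pole at 0.\<close>
    also have "\<dots> \<le> (1 + x) * (1 / (x * y * s))"
      using pos by (intro mult_right_mono real_le_lsqrt) (auto simp: power2_eq_square algebra_simps)
    also have "\<dots> = 1 / (x * y * s) + 1 / (y * s)" using pos by (simp add: field_simps)
    also have "\<dots> \<le> (1 / e) * (1 / x + 1 / s) + 2 * ((1 / d) * (1 / y + 1 / s))"
    proof -
      have "1 / (x * y * s) + 1 / (y * s) \<le> 1 / (x * s) + 2 * (1 / (y * s))"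
        using add_right_mono[OF xys, of "1 / (y * s)"] by (simp only: mult_2 add.assoc)
      also have "\<dots> \<le> (1 / e) * (1 / x + 1 / s) + 2 * ((1 / d) * (1 / y + 1 / s))"
        using xs ys by (intro add_mono mult_left_mono) auto
      finally show ?thesis .
    qed
    also have "\<dots> \<le> K * (1 / x + 1 / y + 1 / s)"
    proof -
      have "0 \<le> (1 / e) * (1 / y)" "0 \<le> (2 / d) * (1 / x)" using pos de by auto
      then show ?thesis by (simp add: K_def algebra_simps)
    qed
    finally show ?thesis by (simp add: x_y_s_def)
  qed
  moreover have "0 \<le> K" using de by (simp add: K_def)
  ultimately show thesis using that by blast
qed

lemma inverse_le_near_kernel: "1 / cmod z \<le> near_kernel z + 1"
proof (cases "cmod z < 1 \<and> z \<noteq> 0")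
  case True
  then have "sqrt (cmod z) \<le> 1" by simp
  then have "cmod z * sqrt (cmod z) \<le> cmod z" by (intro mult_left_le) auto
  then have "1 / cmod z \<le> 1 / (cmod z * sqrt (cmod z))"
    using True by (intro divide_left_mono mult_pos_pos) auto
  then show ?thesis using True by (simp add: near_kernel_def)
next
  case False
  then have "1 / cmod z \<le> 1" by (auto simp: divide_le_eq)
  then show ?thesis using near_kernel_nonneg[of z] by linarith
qed

text \<open>In this region \<open>|z - 1|\<close> and \<open>|z - t|\<close> are at least
  \<open>|z| / 2\<close>, which gives a factor 4; the weight is at most \<open>2 * sqrt |z|\<close>,
  which gives the other factor 2.\<close>

lemma weighted_density_le_far_kernel:
  assumes R: "2 + 2 * cmod t \<le> cmod z"
  shows "weighted_density t z \<le> 8 * far_kernel z"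
proof -
  define x where "x = cmod z"
  have x: "2 \<le> x" "2 * cmod t \<le> x" using R norm_ge_zero[of t] unfolding x_def by linarith+
  have a: "x / 2 \<le> cmod (z - 1)" "x / 2 \<le> cmod (z - t)"
    using norm_triangle_ineq2[of z 1] norm_triangle_ineq2[of z t] x by (auto simp: x_def)
  have nz: "0 < cmod (z * (z - 1) * (z - t))"
    unfolding norm_mult x_def[symmetric] using x a by (intro mult_pos_pos) linarith+
  have "x * (x / 2) * (x / 2) \<le> cmod (z * (z - 1) * (z - t))"
    unfolding norm_mult x_def[symmetric] using x a by (intro mult_mono) auto
  then have "legendre_density t z \<le> 1 / (x * (x / 2) * (x / 2))"
    unfolding legendre_density_def using x
    by (intro divide_left_mono mult_pos_pos nz) auto
  moreover have "sqrt (1 + x) \<le> 2 * sqrt x"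
  proof -
    have "sqrt (1 + x) \<le> sqrt (4 * x)" using x by (intro real_sqrt_le_mono) auto
    then show ?thesis by (simp add: real_sqrt_mult)
  qed
  ultimately have "weighted_density t z \<le> (2 * sqrt x) * (1 / (x * (x / 2) * (x / 2)))"
    unfolding weighted_density_def x_def[symmetric] using x by (intro mult_mono) auto
  also have "\<dots> = 8 * (sqrt x / (x * x * x))" by simp
  also have "sqrt x / (x * x * x) = 1 / (x\<^sup>2 * sqrt x)"
  proof -
    have "x * x * x = x\<^sup>2 * (sqrt x * sqrt x)" using x by (simp add: power2_eq_square)
    then show ?thesis using x by (simp add: field_simps)
  qed
  finally show ?thesis using x by (simp add: far_kernel_def x_def)
qed

lemma integrable_weighted_density:
  assumes t: "t \<noteq> 0" "t \<noteq> 1"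
  shows "integrable lborel (weighted_density t)"
proof -
  obtain K where K: "0 \<le> K"
    "\<And>z. weighted_density t z \<le> K * (1 / cmod z + 1 / cmod (z - 1) + 1 / cmod (z - t))"
    using weighted_density_le_poles[OF t] by metis
  define R where "R = 2 + 2 * cmod t"
  \<comment> \<open>The near kernels and the constant \<open>3 * K\<close> (one \<open>K\<close> for
    each pole) majorise inside the disc of radius \<open>R\<close>, the far kernel outside.\<close>
  define B where "B = (\<lambda>z. K * (near_kernel z + near_kernel (z - 1) + near_kernel (z - t))
      + 3 * K * indicator (cball 0 R) z + 8 * far_kernel z)"
  have fin: "emeasure lborel (cball (0::complex) R) < \<infinity>"
    by (intro emeasure_lborel_cball_finite)
  have "integrable lborel B"
    unfolding B_def using fin
    by (intro Bochner_Integration.integrable_add integrable_mult_right integrable_lborel_shift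
          integrable_near_kernel integrable_far_kernel integrable_real_indicator) auto
  then show ?thesis
  proof (rule Bochner_Integration.integrable_bound)
    show "AE z in lborel. norm (weighted_density t z) \<le> norm (B z)"
    proof (rule AE_I2)
      fix z
      have "weighted_density t z \<le> B z"
      proof (cases "z \<in> cball 0 R")
        case True
        have "K * (1 / cmod z + 1 / cmod (z - 1) + 1 / cmod (z - t))
            \<le> K * ((near_kernel z + 1) + (near_kernel (z - 1) + 1) + (near_kernel (z - t) + 1))"
          using K(1) by (intro mult_left_mono add_mono inverse_le_near_kernel)
        also have "\<dots> = K * (near_kernel z + near_kernel (z - 1) + near_kernel (z - t)) + 3 * K"
          by (simp add: algebra_simps)
        finally show ?thesis using K(2)[of z] True far_kernel_nonneg[of z]
          unfolding B_def by (simp del: far_kernel_nonneg)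
      next
        case False
        then have "weighted_density t z \<le> 8 * far_kernel z"
          by (intro weighted_density_le_far_kernel) (auto simp: R_def)
        moreover have "0 \<le> K * (near_kernel z + near_kernel (z - 1) + near_kernel (z - t))"
          using K(1) by simp
        ultimately show ?thesis using False by (simp add: B_def)
      qed
      then show "norm (weighted_density t z) \<le> norm (B z)"
        using weighted_density_nonneg[of t z] by simp
    qed
  qed simp
qed

lemma legendre_density_le_weighted: "legendre_density t z \<le> weighted_density t z"
proof -
  have "1 * legendre_density t z \<le> sqrt (1 + cmod z) * legendre_density t z"
    by (intro mult_right_mono) auto
  then show ?thesis by (simp add: weighted_density_def)
qed

lemma integrable_legendre_density:
  assumes t: "t \<noteq> 0" "t \<noteq> 1"
  shows "integrable lborel (legendre_density t)"
  using integrable_weighted_density[OF t]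
  by (rule Bochner_Integration.integrable_bound) (auto simp: legendre_density_le_weighted)

text \<open>If \<open>|z - a| < 1\<close>, the product of \<open>1 / |z - p|\<close> and
  \<open>1 / sqrt |z - a|\<close> is at most the power -3/2 of the smaller distance. Each of the
  three poles \<open>p\<close> contributes one kernel at \<open>a\<close> and one at
  \<open>p\<close>. The majorant depends on \<open>a\<close> only through a translation.\<close>

lemma weighted_density_sqrt_le:
  assumes K: "0 \<le> K"
    "\<And>z. weighted_density t z \<le> K * (1 / cmod z + 1 / cmod (z - 1) + 1 / cmod (z - t))"
  shows "weighted_density t z / sqrt (cmod (z - a)) \<le> weighted_density t z +
     K * (3 * near_kernel (z - a) + near_kernel z + near_kernel (z - 1) + near_kernel (z - t))"
proof -
  define b where "b = cmod (z - a)"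
  have nn: "0 \<le> K * (3 * near_kernel (z - a) + near_kernel z + near_kernel (z - 1) + near_kernel (z - t))"
    using K(1) by simp
  consider "b = 0" | "1 \<le> b" | "0 < b" "b < 1" using norm_ge_zero[of "z - a"] unfolding b_def by linarith
  then show ?thesis
  proof cases
    case 1 then show ?thesis using nn weighted_density_nonneg[of t z] unfolding b_def[symmetric] by simp
  next
    case 2
    then have "weighted_density t z / sqrt b \<le> weighted_density t z"
      using divide_left_mono[of 1 "sqrt b" "weighted_density t z"] by simp
    then show ?thesis using nn unfolding b_def[symmetric] by simp
  next
    case 3
    have pole: "1 / cmod (z - p) / sqrt b \<le> near_kernel (z - a) + near_kernel (z - p)" for p
    proof (cases "b \<le> cmod (z - p)")
      case True
      then have "1 / cmod (z - p) \<le> 1 / b" using 3 by (intro divide_left_mono mult_pos_pos) auto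
      then have "1 / cmod (z - p) / sqrt b \<le> 1 / b / sqrt b"
        using 3 by (intro divide_right_mono) auto
      also have "\<dots> = near_kernel (z - a)"
        using 3 by (simp add: near_kernel_def flip: b_def)
      finally show ?thesis using near_kernel_nonneg[of "z - p"] by linarith
    next
      case False
      show ?thesis
      proof (cases "z = p")
        case False
        then have q: "0 < cmod (z - p)" by simp
        have "1 / sqrt b \<le> 1 / sqrt (cmod (z - p))"
          using \<open>\<not> b \<le> cmod (z - p)\<close> q 3 by (intro divide_left_mono mult_pos_pos) auto
        then have "1 / cmod (z - p) * (1 / sqrt b) \<le> 1 / cmod (z - p) * (1 / sqrt (cmod (z - p)))"
          by (intro mult_left_mono) auto
        also have "\<dots> = near_kernel (z - p)"
          using 3 \<open>\<not> b \<le> cmod (z - p)\<close> by (simp add: near_kernel_def)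
        finally show ?thesis using near_kernel_nonneg[of "z - a"]
          by (simp del: near_kernel_nonneg)
      qed simp
    qed
    have "weighted_density t z / sqrt b \<le> K * (1 / cmod z + 1 / cmod (z - 1) + 1 / cmod (z - t)) / sqrt b"
      using K(2) 3 by (intro divide_right_mono) auto
    also have "\<dots> = K * (1 / cmod (z - 0) / sqrt b + 1 / cmod (z - 1) / sqrt b + 1 / cmod (z - t) / sqrt b)"
      unfolding times_divide_eq_right[symmetric] add_divide_distrib by simp
    also have "\<dots> \<le> K * ((near_kernel (z - a) + near_kernel (z - 0)) + (near_kernel (z - a) + near_kernel (z - 1))
         + (near_kernel (z - a) + near_kernel (z - t)))"
      using K(1) by (intro mult_left_mono add_mono pole)
    also have "\<dots> = K * (3 * near_kernel (z - a) + near_kernel z + near_kernel (z - 1) + near_kernel (z - t))"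
      by simp
    finally show ?thesis using weighted_density_nonneg[of t z] unfolding b_def by linarith
  qed
qed

section \<open>Uniform estimates for the logarithmic potential\<close>

lemma abs_ln_le_sqrt:
  fixes u :: real
  assumes "0 < u"
  shows "\<bar>ln u\<bar> \<le> 2 * (sqrt u + 1 / sqrt u)"
proof -
  have "ln (sqrt u) \<le> sqrt u - 1" "ln (1 / sqrt u) \<le> 1 / sqrt u - 1"
    using assms by (auto intro!: ln_le_minus_one)
  moreover have "ln (sqrt u) = ln u / 2" "ln (1 / sqrt u) = - (ln u / 2)"
    using assms by (auto simp: ln_sqrt ln_div)
  moreover have "0 < sqrt u" "0 < 1 / sqrt u" using assms by auto
  ultimately show ?thesis unfolding abs_le_iff distrib_left by linarith
qed

text \<open>With \<open>u\<close> the normalised value of \<open>|z - w y|\<close>, the logarithm is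
  bounded by \<open>sqrt u\<close>, which the weight absorbs, and \<open>1 / sqrt u\<close>, which
  leads to an inverse square root singularity at \<open>z / w\<close>.\<close>

lemma log_kernel_pointwise:
  assumes K: "0 \<le> K"
    "\<And>z. weighted_density t z \<le> K * (1 / cmod z + 1 / cmod (z - 1) + 1 / cmod (z - t))"
  assumes w: "w \<noteq> 0" and y: "y \<noteq> z / w"
  shows "\<bar>ln (cmod (z - w * y)) - ln (max (cmod z) (cmod w))\<bar> * legendre_density t y \<le>
     6 * weighted_density t y +
     2 * K * (3 * near_kernel (y - z / w) + near_kernel y + near_kernel (y - 1) + near_kernel (y - t))"
proof -
  define a where "a = z / w"
  define N where "N = max (cmod z) (cmod w)"
  define u where "u = cmod (z - w * y) / N"
  define b where "b = cmod (y - a)"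
  define l where "l = legendre_density t y"
  define J where "J = weighted_density t y"
  have N: "0 < N" using w by (simp add: N_def less_max_iff_disj)
  have zw: "cmod (z - w * y) = cmod w * b"
  proof -
    have "z - w * y = w * (a - y)" using w by (simp add: a_def algebra_simps)
    then show ?thesis by (simp add: b_def norm_mult norm_minus_commute)
  qed
  have b: "0 < b" using y by (simp add: b_def a_def)
  have u: "0 < u" using N b w by (simp add: u_def zw)
  have l: "0 \<le> l" by (simp add: l_def)
  have "cmod (z - w * y) \<le> N + N * cmod y"
  proof -
    have "cmod (z - w * y) \<le> cmod z + cmod w * cmod y"
      using norm_triangle_ineq4[of z "w * y"] by (simp add: norm_mult)
    also have "\<dots> \<le> N + N * cmod y" by (intro add_mono mult_right_mono) (auto simp: N_def)
    finally show ?thesis .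
  qed
  then have "u \<le> 1 + cmod y" using N by (simp add: u_def field_simps)
  then have 1: "sqrt u * l \<le> J"
    unfolding J_def weighted_density_def l_def[symmetric] using l by (intro mult_right_mono) auto
  \<comment> \<open>Bounding \<open>N\<close> itself by the distance \<open>b\<close> makes the estimate uniform in \<open>a\<close>, including \<open>a\<close> near infinity.\<close>
  have "N \<le> cmod w * (b + (1 + cmod y))"
  proof -
    have "cmod a \<le> b + cmod y" unfolding b_def
      using norm_triangle_ineq4[of y "y - a"] by simp
    then have "cmod w * cmod a \<le> cmod w * (b + cmod y)" by (intro mult_left_mono) auto
    moreover have "cmod z = cmod w * cmod a" using w by (simp add: a_def norm_divide)
    moreover have "cmod w * 1 \<le> cmod w * (b + (1 + cmod y))"
      using b by (intro mult_left_mono) auto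
    moreover have "0 \<le> cmod w * 1" by simp
    ultimately show ?thesis unfolding N_def distrib_left by linarith
  qed
  then have "N / (cmod w * b) \<le> (cmod w * (b + (1 + cmod y))) / (cmod w * b)"
    using b by (intro divide_right_mono) auto
  also have "N / (cmod w * b) = 1 / u" by (simp add: u_def zw)
  also have "(cmod w * (b + (1 + cmod y))) / (cmod w * b) = 1 + (1 + cmod y) / b" using w b by (simp add: field_simps)
  finally have "sqrt (1 / u) \<le> sqrt (1 + (1 + cmod y) / b)" by (rule real_sqrt_le_mono)
  also have "\<dots> \<le> sqrt 1 + sqrt ((1 + cmod y) / b)" using b by (intro sqrt_add_le_add_sqrt) auto
  finally have "1 / sqrt u \<le> 1 + sqrt (1 + cmod y) / sqrt b" by (simp add: real_sqrt_divide)
  then have "1 / sqrt u * l \<le> (1 + sqrt (1 + cmod y) / sqrt b) * l" using l by (intro mult_right_mono)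
  also have "\<dots> = l + J / sqrt b" by (simp add: J_def weighted_density_def l_def algebra_simps)
  also have "\<dots> \<le> J + J / sqrt b" using legendre_density_le_weighted[of t y] by (simp add: l_def J_def)
  finally have 2: "1 / sqrt u * l \<le> J + J / sqrt b" .
  have "ln (cmod (z - w * y)) - ln N = ln u" 
    using N b w zw unfolding u_def by (subst ln_div) auto
  then have "\<bar>ln (cmod (z - w * y)) - ln N\<bar> * l \<le> (2 * (sqrt u + 1 / sqrt u)) * l"
    using abs_ln_le_sqrt[OF u] l by (simp add: mult_right_mono)
  also have "\<dots> = 2 * (sqrt u * l) + 2 * (1 / sqrt u * l)" by (simp add: algebra_simps)
  also have "\<dots> \<le> 4 * J + 2 * (J / sqrt b)" using 1 2 by linarith
  also have "\<dots> \<le> 4 * J + 2 * (J + K * (3 * near_kernel (y - a) + near_kernel y + near_kernel (y - 1) + near_kernel (y - t)))"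
    using weighted_density_sqrt_le[OF K, of y a] by (simp add: J_def b_def)
  finally show ?thesis by (simp add: J_def l_def N_def a_def algebra_simps)
qed

lemma log_kernel_bound:
  assumes t: "t \<noteq> 0" "t \<noteq> 1"
  obtains C where
    "\<And>z w. (z, w) \<noteq> (0, 0) \<Longrightarrow> integrable lborel (\<lambda>y. ln (cmod (z - w * y)) * legendre_density t y)"
    "\<And>z w. (z, w) \<noteq> (0, 0) \<Longrightarrow>
      \<bar>(LINT y|lborel. ln (cmod (z - w * y)) * legendre_density t y)
        - ln (max (cmod z) (cmod w)) * (LINT y|lborel. legendre_density t y)\<bar> \<le> C"
proof -
  obtain K where K: "0 \<le> K"
    "\<And>z. weighted_density t z \<le> K * (1 / cmod z + 1 / cmod (z - 1) + 1 / cmod (z - t))"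
    using weighted_density_le_poles[OF t] by metis
  define H where "H = (\<lambda>a y. 6 * weighted_density t y +
     2 * K * (3 * near_kernel (y - a) + near_kernel y + near_kernel (y - 1) + near_kernel (y - t)))"
  have H: "integrable lborel (H a)" for a
    unfolding H_def
    by (intro Bochner_Integration.integrable_add integrable_mult_right integrable_lborel_shift
          integrable_near_kernel integrable_weighted_density t)
  \<comment> \<open>The coefficient is \<open>12 = 2 * (3 + 1 + 1 + 1)\<close>: all translates of
    \<open>near_kernel\<close> have the same integral, so \<open>C\<close> does not depend on
    \<open>z / w\<close>.\<close>
  define C where "C = 6 * (LINT y|lborel. weighted_density t y) + 12 * K * (LINT y|lborel. near_kernel y)"
  have HC: "(LINT y|lborel. H a y) = C" for a
    unfolding H_def C_def
    by (simp add: integrable_lborel_shift integrable_near_kernel integrable_weighted_density t)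
  have C0: "0 \<le> C"
    using K(1) unfolding C_def by (intro add_nonneg_nonneg mult_nonneg_nonneg integral_nonneg_AE) auto
  have main: "integrable lborel (\<lambda>y. ln (cmod (z - w * y)) * legendre_density t y) \<and>
      \<bar>(LINT y|lborel. ln (cmod (z - w * y)) * legendre_density t y)
        - ln (max (cmod z) (cmod w)) * (LINT y|lborel. legendre_density t y)\<bar> \<le> C"
    if zw: "(z, w) \<noteq> (0, 0)" for z w
  proof (cases "w = 0")
    case True
    then show ?thesis using C0 integrable_legendre_density[OF t] by (simp add: max_absorb1)
  next
    case False
    define N where "N = max (cmod z) (cmod w)"
    define D where "D = (\<lambda>y. (ln (cmod (z - w * y)) - ln N) * legendre_density t y)"
    have [measurable]: "D \<in> borel_measurable borel" unfolding D_def by measurable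
    have bd: "AE y in lborel. norm (D y) \<le> H (z / w) y"
      using AE_lborel_singleton[of "z / w"]
    proof eventually_elim
      case (elim y)
      then show ?case using log_kernel_pointwise[OF K False elim]
        by (simp add: D_def H_def N_def abs_mult)
    qed
    then have D: "integrable lborel D"
      using H by (intro Bochner_Integration.integrable_bound[OF H[of "z / w"]]) (auto elim!: eventually_mono)
    have "\<bar>LINT y|lborel. D y\<bar> \<le> C"
    proof -
      have "\<bar>LINT y|lborel. D y\<bar> \<le> (LINT y|lborel. norm (D y))"
        using integral_norm_bound[of lborel D] by simp
      also have "\<dots> \<le> (LINT y|lborel. H (z / w) y)"
        using D H bd by (intro integral_mono_AE) auto
      finally show ?thesis unfolding HC .
    qed
    moreover have eq: "(\<lambda>y. ln (cmod (z - w * y)) * legendre_density t y) = (\<lambda>y. D y + ln N * legendre_density t y)"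
      by (auto simp: D_def algebra_simps)
    ultimately show ?thesis
      unfolding eq using D integrable_legendre_density[OF t] by (simp add: N_def)
  qed
  then show thesis using that by blast
qed

section \<open>The duplication map and its deck transformations\<close>

definition lex_less :: "complex \<Rightarrow> complex \<Rightarrow> bool" where
  "lex_less a b \<longleftrightarrow> Re a < Re b \<or> (Re a = Re b \<and> Im a < Im b)"

lemma lex_less_linear: "a \<noteq> b \<Longrightarrow> lex_less a b \<or> lex_less b a"
  by (auto simp: lex_less_def complex_eq_iff)

lemma lex_less_asym: "lex_less a b \<Longrightarrow> \<not> lex_less b a"
  by (auto simp: lex_less_def)

lemma lex_less_trans: "lex_less a b \<Longrightarrow> lex_less b c \<Longrightarrow> lex_less a c"
  by (auto simp: lex_less_def)

lemma ex_lex_least: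
  "finite S \<Longrightarrow> S \<noteq> {} \<Longrightarrow> \<exists>m\<in>S. \<forall>y\<in>S. y \<noteq> m \<longrightarrow> lex_less m y"
proof (induction S rule: finite_ne_induct)
  case (insert x S)
  then obtain m where m: "m \<in> S" "\<And>y. y \<in> S \<Longrightarrow> y \<noteq> m \<Longrightarrow> lex_less m y" by blast
  have "x \<noteq> m" using m(1) insert by auto
  then consider "lex_less x m" | "lex_less m x" using lex_less_linear by blast
  then show ?case
  proof cases
    case 1
    then have "\<forall>y\<in>insert x S. y \<noteq> x \<longrightarrow> lex_less x y" using m(2) lex_less_trans by blast
    then show ?thesis by blast
  next
    case 2
    then show ?thesis using m by blast
  qed
qed simp

lemma measurable_lex_less [measurable]:
  assumes [measurable]: "g \<in> borel_measurable borel" "h \<in> borel_measurable borel"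
  shows "Measurable.pred borel (\<lambda>a. lex_less (g a) (h a))"
  unfolding lex_less_def by measurable

section \<open>Algebra of the doubling map\<close>

locale legendre =
  fixes t :: complex
  assumes t0: "t \<noteq> 0" and t1: "t \<noteq> 1"
begin

definition P :: "complex \<Rightarrow> complex" where "P a = (a\<^sup>2 - t)\<^sup>2"
definition Q :: "complex \<Rightarrow> complex" where "Q a = 4 * a * (a - 1) * (a - t)"
text \<open>\<open>f\<close> is the x-coordinate of doubling on the curve \<open>y\<^sup>2 = x (x - 1) (x - t)\<close>, and \<open>s1\<close>, \<open>s2\<close>, \<open>s3\<close>
  are the translations by the points of order two, i.e. the deck transformations of \<open>f\<close>.\<close>

definition f :: "complex \<Rightarrow> complex" where "f a = P a / Q a"
text \<open>The squares of the three quadratic factors are \<open>P\<close>, \<open>P - Q\<close>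
  and \<open>P - t * Q\<close>, so the critical values of \<open>f\<close> are 0, 1 and
  \<open>t\<close>.\<close>

definition f' :: "complex \<Rightarrow> complex" where
  "f' a = 4 * (a\<^sup>2 - t) * (a\<^sup>2 - 2 * a + t) * (a\<^sup>2 - 2 * t * a + t) / (Q a)\<^sup>2"

definition s1 :: "complex \<Rightarrow> complex" where "s1 a = t / a"
definition s2 :: "complex \<Rightarrow> complex" where "s2 a = (a - t) / (a - 1)"
definition s3 :: "complex \<Rightarrow> complex" where "s3 a = t * (a - 1) / (a - t)"

lemma Q_nonzero_iff: "Q a \<noteq> 0 \<longleftrightarrow> a \<noteq> 0 \<and> a \<noteq> 1 \<and> a \<noteq> t"
  by (auto simp: Q_def)

lemma P_nonzero: "Q a = 0 \<Longrightarrow> P a \<noteq> 0"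
  using t0 t1 by (auto simp: Q_def P_def power2_eq_square)

lemma measurable_PQ [measurable]:
  "P \<in> borel_measurable borel" "Q \<in> borel_measurable borel"
  "f \<in> borel_measurable borel" "f' \<in> borel_measurable borel"
  "s1 \<in> borel_measurable borel" "s2 \<in> borel_measurable borel" "s3 \<in> borel_measurable borel"
  unfolding P_def[abs_def] Q_def[abs_def] f_def[abs_def] f'_def[abs_def] s1_def[abs_def] s2_def[abs_def] s3_def[abs_def]
  by measurable

lemma legendre_density_Q: "legendre_density t a = 4 / cmod (Q a)"
  by (simp add: legendre_density_def Q_def norm_mult)

text \<open>The common factor \<open>(s' a)^2\<close> says two things at once: it cancels in
  \<open>P / Q\<close>, so \<open>f\<close> is invariant, and for \<open>Q\<close> alone it makes
  \<open>|dx|^2 / |Q|\<close> invariant.\<close>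

definition deck :: "(complex \<Rightarrow> complex) \<Rightarrow> (complex \<Rightarrow> complex) \<Rightarrow> bool" where
  "deck s s' \<longleftrightarrow> s \<in> borel_measurable borel \<and> s' \<in> borel_measurable borel \<and>
     (\<forall>a. Q a \<noteq> 0 \<longrightarrow> (s has_field_derivative s' a) (at a) \<and> s' a \<noteq> 0 \<and>
        P (s a) = (s' a)\<^sup>2 * P a \<and> Q (s a) = (s' a)\<^sup>2 * Q a \<and> s (s a) = a)"

lemma deck_id: "deck (\<lambda>a. a) (\<lambda>a. 1)"
  by (auto simp: deck_def)

text \<open>The involution swaps 0 with infinity and 1 with \<open>t\<close>. As a quartic form
  \<open>Q\<close> vanishes exactly at these four points, so composing with the involution
  multiplies it by a constant over the fourth power of the denominator. The same reasoning serves
  \<open>s2\<close> and \<open>s3\<close>.\<close>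

lemma deck_s1: "deck s1 (\<lambda>a. - t / a\<^sup>2)"
  unfolding deck_def
proof (intro conjI allI impI)
  fix a assume "Q a \<noteq> 0"
  then have a: "a \<noteq> 0" "a \<noteq> 1" "a \<noteq> t" by (auto simp: Q_nonzero_iff)
  show "(s1 has_field_derivative - t / a\<^sup>2) (at a)"
    unfolding s1_def[abs_def] by (auto intro!: derivative_eq_intros simp: a power2_eq_square)
  show "P (s1 a) = (- t / a\<^sup>2)\<^sup>2 * P a" "Q (s1 a) = (- t / a\<^sup>2)\<^sup>2 * Q a"
    using a unfolding P_def Q_def s1_def by (simp_all add: field_simps) algebra+
qed (use t0 in \<open>auto simp: Q_nonzero_iff s1_def\<close>)

lemma deck_s2: "deck s2 (\<lambda>a. (t - 1) / (a - 1)\<^sup>2)"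
  unfolding deck_def
proof (intro conjI allI impI)
  fix a assume "Q a \<noteq> 0"
  then have a: "a \<noteq> 0" "a - 1 \<noteq> 0" "a - t \<noteq> 0" by (auto simp: Q_nonzero_iff)
  define b where "b = a - 1"
  have ab: "a = b + 1" "b \<noteq> 0" using a by (auto simp: b_def)
  show "(s2 has_field_derivative (t - 1) / (a - 1)\<^sup>2) (at a)"
    unfolding s2_def[abs_def] using a by (auto intro!: derivative_eq_intros simp: power2_eq_square)
  show "(t - 1) / (a - 1)\<^sup>2 \<noteq> 0" using a t1 by simp
  \<comment> \<open>\<open>s2\<close> swaps 0 with \<open>t\<close> and 1 with infinity, so these
    differences are again products of linear factors over \<open>b\<close>.\<close>
  have d: "s2 a - 1 = (1 - t) / b" "s2 a - t = (b + 1) * (1 - t) / b"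
    using ab by (simp_all add: s2_def field_simps)
  have "(a - t)\<^sup>2 - t * b\<^sup>2 = (1 - t) * (a\<^sup>2 - t)"
    unfolding ab(1) by algebra
  then have "((a - t)\<^sup>2 - t * b\<^sup>2) / b\<^sup>2 = (1 - t) * (a\<^sup>2 - t) / b\<^sup>2" by simp
  then have "(s2 a)\<^sup>2 - t = (1 - t) * (a\<^sup>2 - t) / b\<^sup>2"
    using ab(2) by (simp add: s2_def power_divide diff_divide_distrib[of "(a - t)\<^sup>2"] flip: b_def)
  then show "P (s2 a) = ((t - 1) / (a - 1)\<^sup>2)\<^sup>2 * P a"
    by (simp add: P_def power_divide power_mult_distrib power2_commute[of t] flip: b_def)
  have "s2 a = (b + 1 - t) / b" by (simp add: s2_def ab)
  then have "Q (s2 a) = 4 * ((b + 1 - t) / b) * ((1 - t) / b) * ((b + 1) * (1 - t) / b)"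
    by (simp add: Q_def flip: d)
  also have "\<dots> = ((t - 1) / b\<^sup>2)\<^sup>2 * (4 * (b + 1) * b * (b + 1 - t))"
    using ab(2) by (simp add: power2_eq_square power_divide divide_simps) algebra?
  finally show "Q (s2 a) = ((t - 1) / (a - 1)\<^sup>2)\<^sup>2 * Q a"
    by (simp add: Q_def ab)
  from d show "s2 (s2 a) = a"
    using ab t1 by (subst (1) s2_def) simp
qed measurable

lemma deck_s3: "deck s3 (\<lambda>a. t * (1 - t) / (a - t)\<^sup>2)"
  unfolding deck_def
proof (intro conjI allI impI)
  fix a assume "Q a \<noteq> 0"
  then have a: "a \<noteq> 0" "a - 1 \<noteq> 0" "a - t \<noteq> 0" by (auto simp: Q_nonzero_iff)
  define b where "b = a - t"
  have ab: "a = b + t" "b \<noteq> 0" using a by (auto simp: b_def)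
  show "(s3 has_field_derivative t * (1 - t) / (a - t)\<^sup>2) (at a)"
    unfolding s3_def[abs_def] using a
    by (auto intro!: derivative_eq_intros simp: power2_eq_square) (simp add: field_simps)
  show "t * (1 - t) / (a - t)\<^sup>2 \<noteq> 0" using a t0 t1 by simp
  \<comment> \<open>\<open>s3\<close> swaps 0 with 1 and \<open>t\<close> with infinity.\<close>
  have d: "s3 a - 1 = (t - 1) * (b + t) / b" "s3 a - t = t * (t - 1) / b"
    using ab by (simp_all add: s3_def field_simps)
  have "(t * (a - 1))\<^sup>2 - t * b\<^sup>2 = t * (t - 1) * (a\<^sup>2 - t)"
    unfolding ab(1) by algebra
  then have "((t * (a - 1))\<^sup>2 - t * b\<^sup>2) / b\<^sup>2 = t * (t - 1) * (a\<^sup>2 - t) / b\<^sup>2" by simp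
  then have "(s3 a)\<^sup>2 - t = t * (t - 1) * (a\<^sup>2 - t) / b\<^sup>2"
    using ab(2) by (simp add: s3_def power_divide diff_divide_distrib flip: b_def)
  then show "P (s3 a) = (t * (1 - t) / (a - t)\<^sup>2)\<^sup>2 * P a"
    by (simp add: P_def power_divide power_mult_distrib power2_commute[of t 1] flip: b_def)
  have "s3 a = t * (b + t - 1) / b" by (simp add: s3_def ab)
  then have "Q (s3 a) = 4 * (t * (b + t - 1) / b) * ((t - 1) * (b + t) / b) * (t * (t - 1) / b)"
    by (simp add: Q_def flip: d)
  also have "\<dots> = (t * (1 - t) / b\<^sup>2)\<^sup>2 * (4 * (b + t) * (b + t - 1) * b)"
    using ab(2) by (simp add: power2_eq_square power_divide divide_simps) algebra?
  finally show "Q (s3 a) = (t * (1 - t) / (a - t)\<^sup>2)\<^sup>2 * Q a"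
    by (simp add: Q_def ab)
  from d show "s3 (s3 a) = a"
    using ab t0 t1 by (subst (1) s3_def) simp
qed measurable

text \<open>This is the multiplication table of the Klein four-group of 2-torsion
  translations.\<close>

lemma s_compose:
  assumes "Q a \<noteq> 0"
  shows "s1 (s2 a) = s3 a" "s2 (s1 a) = s3 a" "s1 (s3 a) = s2 a" "s3 (s1 a) = s2 a"
    "s2 (s3 a) = s1 a" "s3 (s2 a) = s1 a"
proof -
  have a: "a \<noteq> 0" "a - 1 \<noteq> 0" "a - t \<noteq> 0" using assms by (auto simp: Q_nonzero_iff)
  show "s1 (s2 a) = s3 a" "s1 (s3 a) = s2 a" using a t0 by (simp_all add: s1_def s2_def s3_def)
  have d: "s1 a - 1 = - ((a - t) / a)" "s1 a - t = - (t * (a - 1) / a)"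
    using a by (simp_all add: s1_def field_simps)
  show "s2 (s1 a) = s3 a"
    using a t0 unfolding s2_def[of "s1 a"] d by (simp add: s3_def)
  show "s3 (s1 a) = s2 a"
    using a t0 unfolding s3_def[of "s1 a"] d by (simp add: s2_def)
  have "s3 a - 1 = (t - 1) * a / (a - t)" "s3 a - t = t * (t - 1) / (a - t)"
    using a by (simp_all add: s3_def field_simps)
  then show "s2 (s3 a) = s1 a" using a t0 t1 by (subst s2_def) (simp add: s1_def)
  have "s2 a - 1 = - ((t - 1) / (a - 1))" "s2 a - t = - (a * (t - 1) / (a - 1))"
    using a by (simp_all add: s2_def field_simps)
  then show "s3 (s2 a) = s1 a" using a t0 t1 by (subst s3_def) (simp add: s1_def)
qed

text \<open>If adding a 2-torsion point T to R preserves the x-coordinate, then R + T = -R, so 2R =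
  T and \<open>f\<close> takes the value x(T). Away from these values the deck group acts
  freely.\<close>

lemma s_fixed:
  assumes "Q a \<noteq> 0"
  shows "s1 a = a \<Longrightarrow> f a = 0" "s2 a = a \<Longrightarrow> f a = 1" "s3 a = a \<Longrightarrow> f a = t"
proof -
  have a: "a \<noteq> 0" "a - 1 \<noteq> 0" "a - t \<noteq> 0" using assms by (auto simp: Q_nonzero_iff)
  show "f a = 0" if "s1 a = a"
  proof -
    have "a\<^sup>2 = t" using that a by (simp add: s1_def field_simps power2_eq_square)
    then show ?thesis by (simp add: f_def P_def)
  qed
  show "f a = 1" if "s2 a = a"
  proof -
    have "a - t = a * (a - 1)" using that a by (simp add: s2_def divide_eq_eq)
    then have "P a = Q a" unfolding P_def Q_def by algebra
    then show ?thesis using assms by (simp add: f_def)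
  qed
  show "f a = t" if "s3 a = a"
  proof -
    have "t * (a - 1) = a * (a - t)" using that a by (simp add: s3_def divide_eq_eq)
    then have "P a = t * Q a" unfolding P_def Q_def by algebra
    then show ?thesis using assms by (simp add: f_def)
  qed
qed

text \<open>The quartic in \<open>x\<close> is monic and its roots are the orbit of
  \<open>a\<close>. Being monic, it leaves no constant behind when logarithms are taken.\<close>

lemma fibre_factor:
  assumes "Q a \<noteq> 0"
  shows "P x - f a * Q x = (x - a) * (x - s1 a) * (x - s2 a) * (x - s3 a)"
proof -
  have a: "a \<noteq> 0" "a - 1 \<noteq> 0" "a - t \<noteq> 0" using assms by (auto simp: Q_nonzero_iff)
  \<comment> \<open>In this form without denominators the identity is polynomial; the denominators
    \<open>a\<close>, \<open>a - 1\<close>, \<open>a - t\<close> of the involutions and the 4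
    multiply to \<open>Q a\<close>.\<close>
  have "P x * Q a - P a * Q x = 4 * ((x - a) * (a * x - t) * ((a - 1) * x - (a - t)) * ((a - t) * x - t * (a - 1)))"
    unfolding P_def Q_def by algebra
  also have "a * x - t = a * (x - s1 a)" using a by (simp add: s1_def field_simps)
  also have "(a - 1) * x - (a - t) = (a - 1) * (x - s2 a)" 
  proof -
    have "(a - 1) * s2 a = a - t" using a by (simp add: s2_def)
    then show ?thesis by (simp only: right_diff_distrib)
  qed
  also have "(a - t) * x - t * (a - 1) = (a - t) * (x - s3 a)" 
  proof -
    have "(a - t) * s3 a = t * (a - 1)" using a by (simp add: s3_def)
    then show ?thesis by (simp only: right_diff_distrib)
  qed
  finally have "P x * Q a - P a * Q x = Q a * ((x - a) * (x - s1 a) * (x - s2 a) * (x - s3 a))"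
    unfolding Q_def by (simp only: mult_ac)
  moreover have "P x * Q a - P a * Q x = Q a * (P x - f a * Q x)"
    using assms by (simp add: f_def field_simps)
  ultimately show ?thesis using assms by simp
qed

lemma f_deriv:
  assumes "Q a \<noteq> 0"
  shows "(f has_field_derivative f' a) (at a)"
proof -
  have P: "(P has_field_derivative 4 * a * (a\<^sup>2 - t)) (at a)"
    unfolding P_def[abs_def] by (auto intro!: derivative_eq_intros)
  have Q: "(Q has_field_derivative 4 * ((a - 1) * (a - t) + a * (a - t) + a * (a - 1))) (at a)"
    unfolding Q_def[abs_def] by (auto intro!: derivative_eq_intros simp: algebra_simps)
  have eq: "4 * a * (a\<^sup>2 - t) * Q a - P a * (4 * ((a - 1) * (a - t) + a * (a - t) + a * (a - 1)))
     = 4 * (a\<^sup>2 - t) * (a\<^sup>2 - 2 * a + t) * (a\<^sup>2 - 2 * t * a + t)"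
    unfolding P_def Q_def by algebra
  show ?thesis
    using DERIV_divide[OF P Q assms] unfolding f_def[abs_def] f'_def eq[symmetric]
    by (simp add: power2_eq_square)
qed

text \<open>Doubling multiplies the invariant differential \<open>dx / y\<close> by two, hence \<open>|dx / y|\<^sup>2\<close> by four.\<close>

lemma density_pullback:
  assumes Q: "Q a \<noteq> 0" and "f a \<noteq> 0" "f a \<noteq> 1" "f a \<noteq> t"
  shows "(cmod (f' a))\<^sup>2 * legendre_density t (f a) = 4 * legendre_density t a"
proof -
  let ?g = "f a * (f a - 1) * (f a - t)"
  have P: "P a = f a * Q a" using Q by (simp add: f_def)
  have 1: "(a\<^sup>2 - t)\<^sup>2 = f a * Q a" using P by (simp add: P_def)
  have 2: "(a\<^sup>2 - 2 * a + t)\<^sup>2 = (f a - 1) * Q a"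
  proof -
    have "(a\<^sup>2 - 2 * a + t)\<^sup>2 = P a - Q a" unfolding P_def Q_def by algebra
    then show ?thesis by (simp add: P algebra_simps)
  qed
  have 3: "(a\<^sup>2 - 2 * t * a + t)\<^sup>2 = (f a - t) * Q a"
  proof -
    have "(a\<^sup>2 - 2 * t * a + t)\<^sup>2 = P a - t * Q a" unfolding P_def Q_def by algebra
    then show ?thesis by (simp add: P algebra_simps)
  qed
  have "(f' a)\<^sup>2 = 16 * (f a * Q a) * ((f a - 1) * Q a) * ((f a - t) * Q a) / ((Q a)\<^sup>2)\<^sup>2"
    unfolding f'_def power_divide power_mult_distrib 1 2 3 by simp
  also have "\<dots> = 16 * ?g / Q a"
    using Q by (simp add: field_simps power2_eq_square)
  finally have "(cmod (f' a))\<^sup>2 = 16 * cmod ?g / cmod (Q a)"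
    by (simp add: norm_divide norm_mult flip: norm_power)
  then show ?thesis
    using assms by (simp add: legendre_density_Q[of a]) (simp add: legendre_density_def norm_mult)
qed

section \<open>Fibres of \<open>f\<close> and a fundamental domain\<close>

lemma fibre_exists: "\<exists>a. Q a \<noteq> 0 \<and> f a = z"
proof -
  \<comment> \<open>\<open>p\<close> is the expansion of \<open>P - z * Q\<close>, monic of degree 4
    for every \<open>z\<close>. Its roots are not poles of \<open>f\<close>, since \<open>P\<close>
    and \<open>Q\<close> have no common zero.\<close>
  define p where "p = [:t\<^sup>2, -4 * z * t, -2 * t + 4 * z * (1 + t), -4 * z, 1:]"
  have p: "poly p a = P a - z * Q a" for a
    unfolding p_def P_def Q_def by simp algebra
  have "\<not> constant (poly p)" by (simp add: constant_degree p_def)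
  then obtain a where "poly p a = 0" using fundamental_theorem_of_algebra by blast
  then have a: "P a = z * Q a" by (simp add: p)
  then have "Q a \<noteq> 0" using P_nonzero by auto
  then show ?thesis using a by (auto simp: f_def)
qed

lemma finite_fibre: "finite {a. Q a \<noteq> 0 \<and> f a = z}"
proof -
  define p where "p = [:t\<^sup>2, -4 * z * t, -2 * t + 4 * z * (1 + t), -4 * z, 1:]"
  have p: "poly p a = P a - z * Q a" for a
    unfolding p_def P_def Q_def by simp algebra
  have "p \<noteq> 0" by (simp add: p_def)
  then have "finite {a. poly p a = 0}" by (rule poly_roots_finite)
  then show ?thesis by (rule finite_subset[rotated]) (auto simp: p f_def)
qed

lemma deckD:
  assumes "deck s s'" "Q a \<noteq> 0"
  shows "(s has_field_derivative s' a) (at a)" "s (s a) = a" "Q (s a) \<noteq> 0" "f (s a) = f a"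
    "(cmod (s' a))\<^sup>2 * legendre_density t (s a) = legendre_density t a"
proof -
  have *: "(s has_field_derivative s' a) (at a)" "s' a \<noteq> 0"
        "P (s a) = (s' a)\<^sup>2 * P a" "Q (s a) = (s' a)\<^sup>2 * Q a" "s (s a) = a"
    using assms unfolding deck_def by auto
  show "(s has_field_derivative s' a) (at a)" "s (s a) = a" by fact+
  show "Q (s a) \<noteq> 0" "f (s a) = f a" using * assms(2) by (auto simp: f_def)
  show "(cmod (s' a))\<^sup>2 * legendre_density t (s a) = legendre_density t a"
    using *(2) unfolding legendre_density_Q *(4) by (simp add: norm_mult norm_power)
qed


text \<open>Choosing in each fibre of \<open>f\<close> outside \<open>B\<close> the lexicographically least point yields a measurable
  fundamental domain for the deck group without any geometry.\<close>

definition Reg :: "complex set \<Rightarrow> complex set" where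
  "Reg B = {a. Q a \<noteq> 0 \<and> f a \<notin> B}"

definition Dom :: "complex set \<Rightarrow> complex set" where
  "Dom B = {a \<in> Reg B. lex_less a (s1 a) \<and> lex_less a (s2 a) \<and> lex_less a (s3 a)}"

lemma finite_compl_Reg:
  assumes "finite B"
  shows "finite (- Reg B)"
proof -
  have "- Reg B \<subseteq> {0, 1, t} \<union> (\<Union>z\<in>B. {a. Q a \<noteq> 0 \<and> f a = z})"
    using Q_nonzero_iff by (auto simp: Reg_def)
  then show ?thesis by (rule finite_subset) (use assms finite_fibre in auto)
qed

lemma measurable_Reg [measurable]: "finite B \<Longrightarrow> Reg B \<in> sets borel"
  by (intro borel_open) (simp add: open_closed finite_imp_closed finite_compl_Reg)

lemma measurable_Dom [measurable]: "finite B \<Longrightarrow> Dom B \<in> sets borel"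
  using measurable_Reg[of B] unfolding Dom_def by measurable

lemma deck_Reg: "deck s s' \<Longrightarrow> a \<in> Reg B \<Longrightarrow> s a \<in> Reg B"
  by (auto simp: Reg_def deckD)

text \<open>As \<open>s\<close> is an involution of \<open>Reg B\<close>, the image is also a
  preimage, which shows that it is Borel.\<close>

lemma deck_image_Dom:
  assumes s: "deck s s'"
  shows "s ` Dom B = {a \<in> Reg B. s a \<in> Dom B}"
proof -
  have "s a \<in> Reg B" "s (s a) = a" if "a \<in> Reg B" for a
    using that deck_Reg[OF s] deckD(2)[OF s] by (auto simp: Reg_def)
  then show ?thesis unfolding Dom_def by (auto simp: image_iff) (metis+)
qed

lemma inj_on_deck_Dom: "deck s s' \<Longrightarrow> inj_on s (Dom B)"
  by (rule inj_on_inverseI[where g = s]) (auto simp: Dom_def Reg_def deckD)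

text \<open>The orbit consists of four distinct points, and precisely its least one lies in
  \<open>Dom B\<close>. Hence the four images of \<open>Dom B\<close> partition
  \<open>Reg B\<close>.\<close>

lemma orbit_representative:
  assumes B: "{0, 1, t} \<subseteq> B" and a: "a \<in> Reg B"
  shows "(a \<in> Dom B \<or> s1 a \<in> Dom B \<or> s2 a \<in> Dom B \<or> s3 a \<in> Dom B) \<and>
    \<not> (a \<in> Dom B \<and> s1 a \<in> Dom B) \<and> \<not> (a \<in> Dom B \<and> s2 a \<in> Dom B) \<and>
    \<not> (a \<in> Dom B \<and> s3 a \<in> Dom B) \<and> \<not> (s1 a \<in> Dom B \<and> s2 a \<in> Dom B) \<and>
    \<not> (s1 a \<in> Dom B \<and> s3 a \<in> Dom B) \<and> \<not> (s2 a \<in> Dom B \<and> s3 a \<in> Dom B)"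
proof -
  have Q: "Q a \<noteq> 0" and f: "f a \<noteq> 0" "f a \<noteq> 1" "f a \<noteq> t" using a B by (auto simp: Reg_def)
  have R: "s1 a \<in> Reg B" "s2 a \<in> Reg B" "s3 a \<in> Reg B"
    using a deck_Reg deck_s1 deck_s2 deck_s3 by blast+
  note inv = deckD(2)[OF deck_s1 Q] deckD(2)[OF deck_s2 Q] deckD(2)[OF deck_s3 Q]
  note comp = s_compose[OF Q]
  have ne: "s1 a \<noteq> a" "s2 a \<noteq> a" "s3 a \<noteq> a" using s_fixed[OF Q] f by auto
  \<comment> \<open>Applying one of the two involutions turns such an equality into a fixed point of
    the third.\<close>
  have ne': "s1 a \<noteq> s2 a" "s1 a \<noteq> s3 a" "s2 a \<noteq> s3 a"
    using ne inv comp by metis+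
  have D: "a \<in> Dom B \<longleftrightarrow> lex_less a (s1 a) \<and> lex_less a (s2 a) \<and> lex_less a (s3 a)"
    "s1 a \<in> Dom B \<longleftrightarrow> lex_less (s1 a) a \<and> lex_less (s1 a) (s2 a) \<and> lex_less (s1 a) (s3 a)"
    "s2 a \<in> Dom B \<longleftrightarrow> lex_less (s2 a) a \<and> lex_less (s2 a) (s1 a) \<and> lex_less (s2 a) (s3 a)"
    "s3 a \<in> Dom B \<longleftrightarrow> lex_less (s3 a) a \<and> lex_less (s3 a) (s1 a) \<and> lex_less (s3 a) (s2 a)"
    using a R by (auto simp: Dom_def inv comp)
  have "\<exists>m\<in>{a, s1 a, s2 a, s3 a}. \<forall>y\<in>{a, s1 a, s2 a, s3 a}. y \<noteq> m \<longrightarrow> lex_less m y"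
    by (rule ex_lex_least) auto
  then have "a \<in> Dom B \<or> s1 a \<in> Dom B \<or> s2 a \<in> Dom B \<or> s3 a \<in> Dom B"
    unfolding D using ne ne' by auto
  then show ?thesis unfolding D
    using lex_less_asym[of a "s1 a"] lex_less_asym[of a "s2 a"] lex_less_asym[of a "s3 a"]
      lex_less_asym[of "s1 a" "s2 a"] lex_less_asym[of "s1 a" "s3 a"] lex_less_asym[of "s2 a" "s3 a"]
    by argo
qed

lemma f_image_Dom:
  assumes B: "{0, 1, t} \<subseteq> B"
  shows "f ` Dom B = - B"
proof (intro equalityI subsetI)
  fix z assume "z \<in> - B"
  then obtain a where a: "a \<in> Reg B" "f a = z" using fibre_exists[of z] by (auto simp: Reg_def)
  then have "f (s1 a) = z" "f (s2 a) = z" "f (s3 a) = z"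
    using deckD(4) deck_s1 deck_s2 deck_s3 by (auto simp: Reg_def)
  then show "z \<in> f ` Dom B"
    using orbit_representative[OF B a(1), THEN conjunct1] a(2) by (elim disjE) (metis imageI)+
qed (auto simp: Dom_def Reg_def)

text \<open>By \<open>fibre_factor\<close>, points with equal values lie in one orbit, and an orbit
  meets \<open>Dom B\<close> only once.\<close>

lemma f_inj_on_Dom:
  assumes B: "{0, 1, t} \<subseteq> B"
  shows "inj_on f (Dom B)"
proof (rule inj_onI)
  fix a b assume ab: "a \<in> Dom B" "b \<in> Dom B" "f a = f b"
  then have Q: "Q a \<noteq> 0" "Q b \<noteq> 0" and R: "a \<in> Reg B" by (auto simp: Dom_def Reg_def)
  have "P b - f a * Q b = 0" using ab(3) Q by (simp add: f_def)
  then have "b = a \<or> b = s1 a \<or> b = s2 a \<or> b = s3 a" using fibre_factor[OF Q(1), of b] by auto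
  then show "a = b" using orbit_representative[OF B R, THEN conjunct2] ab by (elim disjE) auto
qed

end

section \<open>The functional equation and the escape rate\<close>

lemma LINT_finite_compl:
  fixes h :: "complex \<Rightarrow> real"
  assumes h [measurable]: "h \<in> borel_measurable borel" and A [measurable]: "A \<in> sets borel" and "finite (- A)"
  shows "(LINT z:A|lborel. h z) = (LINT z|lborel. h z)"
  unfolding set_lebesgue_integral_def
proof (rule integral_cong_AE)
  show "AE z in lborel. indicator A z *\<^sub>R h z = h z"
    using AE_not_in[OF finite_imp_null_set_lborel[OF assms(3)]] by eventually_elim simp
qed auto

context legendre
begin

text \<open>\<open>1 / rhoLambda t\<close> is \<open>2 * |t (t - 1)|\<close> times this
  number.\<close>

definition mass :: real where
  "mass = (LINT y|lborel. legendre_density t y)"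

definition pot :: "complex \<Rightarrow> complex \<Rightarrow> real" where
  "pot z w = (LINT y|lborel. ln (cmod (z - w * y)) * legendre_density t y)"

lemma mass_pos: "0 < mass"
proof -
  have int: "integrable lborel (legendre_density t)"
    by (rule integrable_legendre_density[OF t0 t1])
  have "mass \<noteq> 0"
  proof
    assume "mass = 0"
    then have "AE y in lborel. legendre_density t y = 0"
      unfolding mass_def using integral_nonneg_eq_0_iff_AE[OF int] by simp
    moreover have "AE y in lborel. y \<notin> {0, 1, t}"
      by (intro AE_not_in finite_imp_null_set_lborel) auto
    ultimately have "AE y in lborel::complex measure. False"
      by eventually_elim (auto simp: legendre_density_def)
    then have "emeasure lborel (UNIV :: complex set) = 0"
      by (simp add: AE_iff_measurable[of UNIV])
    then show False by simp
  qed
  moreover have "0 \<le> mass" unfolding mass_def by (intro integral_nonneg_AE) auto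
  ultimately show ?thesis by simp
qed

lemma integrable_pot:
  "(z, w) \<noteq> (0, 0) \<Longrightarrow> integrable lborel (\<lambda>y. ln (cmod (z - w * y)) * legendre_density t y)"
  using log_kernel_bound[OF t0 t1] by metis

lemma pot_bound:
  obtains C where "\<And>z w. (z, w) \<noteq> (0, 0) \<Longrightarrow> \<bar>pot z w - ln (max (cmod z) (cmod w)) * mass\<bar> \<le> C"
  using log_kernel_bound[OF t0 t1] unfolding pot_def mass_def by metis

lemma pot_scale:
  assumes c: "c \<noteq> 0" and zw: "(z, w) \<noteq> (0, 0)"
  shows "pot (c * z) (c * w) = ln (cmod c) * mass + pot z w"
proof -
  have "pot (c * z) (c * w) = (LINT y|lborel. ln (cmod c) * legendre_density t y
      + ln (cmod (z - w * y)) * legendre_density t y)"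
    unfolding pot_def
  proof (rule integral_cong_AE)
    show "AE y in lborel. ln (cmod (c * z - c * w * y)) * legendre_density t y =
       ln (cmod c) * legendre_density t y + ln (cmod (z - w * y)) * legendre_density t y"
      \<comment> \<open>Where \<open>z - w * y\<close> vanishes the convention
        \<open>ln 0 = 0\<close> breaks additivity; for \<open>w \<noteq> 0\<close> this is the
        single point removed here.\<close>
      using AE_lborel_singleton[of "z / w"]
    proof eventually_elim
      case (elim y)
      then have "z - w * y \<noteq> 0" using zw by (cases "w = 0") (auto simp: eq_divide_eq mult.commute)
      moreover have "c * z - c * w * y = c * (z - w * y)" by (simp add: algebra_simps)
      ultimately have "ln (cmod (c * z - c * w * y)) = ln (cmod c) + ln (cmod (z - w * y))"
        using c by (simp add: norm_mult ln_mult)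
      then show ?case by (simp only: distrib_right)
    qed
  qed auto
  also have "\<dots> = ln (cmod c) * mass + pot z w"
    using integrable_legendre_density[OF t0 t1] integrable_pot[OF zw] by (simp add: mass_def pot_def)
  finally show ?thesis .
qed

text \<open>Invariance of the density absorbs the Jacobian of \<open>s\<close>, so only
  \<open>L\<close> is composed with \<open>s\<close>.\<close>

lemma deck_transfer:
  assumes B: "finite B" and s: "deck s s'"
    and L [measurable]: "L \<in> borel_measurable borel"
    and int: "integrable lborel (\<lambda>a. L a * legendre_density t a)"
  shows "set_integrable lborel (Dom B) (\<lambda>a. L (s a) * legendre_density t a)"
    and "(LINT a:Dom B|lborel. L (s a) * legendre_density t a)
       = (LINT a:s ` Dom B|lborel. L a * legendre_density t a)"
    and "set_integrable lborel (s ` Dom B) (\<lambda>a. L a * legendre_density t a)"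
proof -
  have [measurable]: "s \<in> borel_measurable borel" "s' \<in> borel_measurable borel"
    using s by (auto simp: deck_def)
  have [measurable]: "Dom B \<in> sets borel" "Reg B \<in> sets borel" using B by auto
  have im [measurable]: "s ` Dom B \<in> sets borel" unfolding deck_image_Dom[OF s] by measurable
  show si: "set_integrable lborel (s ` Dom B) (\<lambda>a. L a * legendre_density t a)"
    unfolding set_integrable_def using int by (intro integrable_mult_indicator) auto
  have der: "(s has_field_derivative s' a) (at a)" if "a \<in> Dom B" for a
    using that deckD(1)[OF s] by (auto simp: Dom_def Reg_def)
  have eq: "(cmod (s' a))\<^sup>2 * (L (s a) * legendre_density t (s a)) = L (s a) * legendre_density t a"
    if "a \<in> Dom B" for a
    using that deckD(5)[OF s, of a] by (auto simp: Dom_def Reg_def mult.left_commute)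
  note cov = complex_change_of_variables[of "Dom B" s "\<lambda>a. L a * legendre_density t a" s',
      OF _ im _ _ _ der inj_on_deck_Dom[OF s] si]
  have "set_integrable lborel (Dom B) (\<lambda>a. (cmod (s' a))\<^sup>2 * (L (s a) * legendre_density t (s a)))"
    by (rule cov(1)) auto
  then show "set_integrable lborel (Dom B) (\<lambda>a. L (s a) * legendre_density t a)"
    by (subst set_integrable_cong[OF refl refl eq[symmetric]])
  have "(LINT a:Dom B|lborel. (cmod (s' a))\<^sup>2 * (L (s a) * legendre_density t (s a)))
       = (LINT a:s ` Dom B|lborel. L a * legendre_density t a)"
    by (rule cov(2)) auto
  then show "(LINT a:Dom B|lborel. L (s a) * legendre_density t a)
       = (LINT a:s ` Dom B|lborel. L a * legendre_density t a)"
    by (subst set_lebesgue_integral_cong[where g = "\<lambda>a. (cmod (s' a))\<^sup>2 * (L (s a) * legendre_density t (s a))"])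
       (auto simp: eq)
qed

lemma pot_functional_equation_affine: "pot (P x) (Q x) = 4 * pot x 1"
proof -
  \<comment> \<open>Removed are the critical values and the value \<open>f x\<close>, where the
    logarithm is singular; if \<open>x\<close> is a pole of \<open>f\<close>, that value is infinity
    and nothing more is removed.\<close>
  define B where "B = {0, 1, t} \<union> (if Q x = 0 then {} else {P x / Q x})"
  have B: "finite B" "{0, 1, t} \<subseteq> B" by (auto simp: B_def)
  have nz: "P x - Q x * z \<noteq> 0" if "z \<notin> B" for z
    using that P_nonzero[of x] by (auto simp: B_def split: if_splits simp: field_simps)
  have PQ: "(P x, Q x) \<noteq> (0, 0)" using P_nonzero[of x] by auto
  define h where "h = (\<lambda>z. ln (cmod (P x - Q x * z)) * legendre_density t z)"
  define L where "L = (\<lambda>a. ln (cmod (x - a)))"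
  have [measurable]: "h \<in> borel_measurable borel" "L \<in> borel_measurable borel"
    unfolding h_def L_def by measurable
  have [measurable]: "Dom B \<in> sets borel" "Reg B \<in> sets borel" using B by auto
  have mB [measurable]: "- B \<in> sets borel" using B(1) by (intro borel_comp borel_closed finite_imp_closed)
  have hint: "integrable lborel h" unfolding h_def by (rule integrable_pot[OF PQ])
  have Lint: "integrable lborel (\<lambda>a. L a * legendre_density t a)"
    using integrable_pot[of x 1] by (simp add: L_def)
  note fD = f_image_Dom[OF B(2)]
  have hset: "set_integrable lborel (f ` Dom B) h"
    unfolding set_integrable_def fD using hint mB by (intro integrable_mult_indicator) auto
  have DQ: "Q a \<noteq> 0" "f a \<notin> B" if "a \<in> Dom B" for a using that by (auto simp: Dom_def Reg_def)
  have der: "(f has_field_derivative f' a) (at a)" if "a \<in> Dom B" for a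
    using f_deriv DQ that by auto
  note decks = deck_id deck_s1 deck_s2 deck_s3
  define T where "T = (\<lambda>s a. L (s a) * legendre_density t a)"
  have eq: "(cmod (f' a))\<^sup>2 * h (f a) = 4 * (T (\<lambda>a. a) a + T s1 a + T s2 a + T s3 a)"
    if a: "a \<in> Dom B" for a
  proof -
    have fa: "f a \<noteq> 0" "f a \<noteq> 1" "f a \<noteq> t" using DQ(2)[OF a] B(2) by auto
    \<comment> \<open>None of the four factors vanishes because \<open>f a\<close> is outside
      \<open>B\<close>, so the logarithm splits. The factor 4 comes from the pullback of the
      density.\<close>
    have fac: "P x - Q x * f a = (x - a) * (x - s1 a) * (x - s2 a) * (x - s3 a)"
      using fibre_factor[OF DQ(1)[OF a], of x] by (simp add: mult.commute)
    then have "x - a \<noteq> 0" "x - s1 a \<noteq> 0" "x - s2 a \<noteq> 0" "x - s3 a \<noteq> 0"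
      using nz[OF DQ(2)[OF a]] by auto
    then have "ln (cmod (P x - Q x * f a)) = L a + L (s1 a) + L (s2 a) + L (s3 a)"
      unfolding fac L_def by (simp add: norm_mult ln_mult)
    then have "(cmod (f' a))\<^sup>2 * h (f a)
        = (L a + L (s1 a) + L (s2 a) + L (s3 a)) * ((cmod (f' a))\<^sup>2 * legendre_density t (f a))"
      by (simp add: h_def)
    also have "\<dots> = (L a + L (s1 a) + L (s2 a) + L (s3 a)) * (4 * legendre_density t a)"
      by (simp only: density_pullback[OF DQ(1)[OF a] fa])
    also have "\<dots> = 4 * (T (\<lambda>a. a) a + T s1 a + T s2 a + T s3 a)"
      by (simp add: T_def algebra_simps)
    finally show ?thesis .
  qed
  have Ti: "set_integrable lborel (Dom B) (T s)"
    "(LINT a:Dom B|lborel. T s a) = (LINT a:s ` Dom B|lborel. L a * legendre_density t a)"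
    "set_integrable lborel (s ` Dom B) (\<lambda>a. L a * legendre_density t a)"
    if "deck s s'" for s s'
    using deck_transfer[OF B(1) that _ Lint] unfolding T_def by auto
  have "pot (P x) (Q x) = (LINT z|lborel. h z)" by (simp add: pot_def h_def)
  also have "\<dots> = (LINT z:f ` Dom B|lborel. h z)"
    unfolding fD by (rule LINT_finite_compl[symmetric]) (use B(1) in auto)
  also have "\<dots> = (LINT a:Dom B|lborel. (cmod (f' a))\<^sup>2 * h (f a))"
    by (rule complex_change_of_variables(2)[symmetric, OF _ _ _ _ _ der f_inj_on_Dom[OF B(2)] hset])
       (auto simp: fD mB)
  also have "\<dots> = (LINT a:Dom B|lborel. 4 * (T (\<lambda>a. a) a + T s1 a + T s2 a + T s3 a))"
    by (rule set_lebesgue_integral_cong) (auto simp: eq)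
  also have "\<dots> = 4 * ((LINT a:Dom B|lborel. T (\<lambda>a. a) a) + (LINT a:Dom B|lborel. T s1 a)
      + (LINT a:Dom B|lborel. T s2 a) + (LINT a:Dom B|lborel. T s3 a))"
    using decks[THEN Ti(1)] by (simp add: set_integral_add)
  \<comment> \<open>Each summand is moved to a translate of the fundamental domain; the four
    translates tile \<open>Reg B\<close>, so a single integral of \<open>L\<close> remains.\<close>
  also have "\<dots> = 4 * (LINT a:Reg B|lborel. L a * legendre_density t a)"
  proof -
    let ?M = "\<lambda>a. L a * legendre_density t a"
    note im = decks[THEN deck_image_Dom, of B]
    have Un: "Reg B = (((\<lambda>a. a) ` Dom B \<union> s1 ` Dom B) \<union> s2 ` Dom B) \<union> s3 ` Dom B"
      unfolding im
    proof (intro equalityI subsetI)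
      fix a assume a: "a \<in> Reg B"
      from orbit_representative[OF B(2) a, THEN conjunct1]
      show "a \<in> (({a \<in> Reg B. a \<in> Dom B} \<union> {a \<in> Reg B. s1 a \<in> Dom B}) \<union> {a \<in> Reg B. s2 a \<in> Dom B})
          \<union> {a \<in> Reg B. s3 a \<in> Dom B}"
        using a by (elim disjE) simp_all
    qed auto
    have unique: "\<not> (a \<in> Dom B \<and> s1 a \<in> Dom B)" "\<not> (a \<in> Dom B \<and> s2 a \<in> Dom B)"
      "\<not> (a \<in> Dom B \<and> s3 a \<in> Dom B)" "\<not> (s1 a \<in> Dom B \<and> s2 a \<in> Dom B)"
      "\<not> (s1 a \<in> Dom B \<and> s3 a \<in> Dom B)" "\<not> (s2 a \<in> Dom B \<and> s3 a \<in> Dom B)"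
      if "a \<in> Reg B" for a
      using orbit_representative[OF B(2) that, THEN conjunct2] by simp_all
    have dj: "(\<lambda>a. a) ` Dom B \<inter> s1 ` Dom B = {}"
      "((\<lambda>a. a) ` Dom B \<union> s1 ` Dom B) \<inter> s2 ` Dom B = {}"
      "(((\<lambda>a. a) ` Dom B \<union> s1 ` Dom B) \<union> s2 ` Dom B) \<inter> s3 ` Dom B = {}"
      unfolding im by (auto dest: unique)
    have meas: "s ` Dom B \<in> sets lborel" if "deck s s'" for s s'
    proof -
      have [measurable]: "s \<in> borel_measurable borel" using that by (simp add: deck_def)
      show ?thesis unfolding deck_image_Dom[OF that] by measurable
    qed
    have i1: "set_integrable lborel ((\<lambda>a. a) ` Dom B \<union> s1 ` Dom B) ?M"
      by (rule set_integrable_Un[OF decks(1,2)[THEN Ti(3)] decks(1,2)[THEN meas]])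
    have i2: "set_integrable lborel (((\<lambda>a. a) ` Dom B \<union> s1 ` Dom B) \<union> s2 ` Dom B) ?M"
      by (rule set_integrable_Un[OF i1 decks(3)[THEN Ti(3)] sets.Un[OF decks(1,2)[THEN meas]] decks(3)[THEN meas]])
    show ?thesis
      unfolding Un set_integral_Un[OF dj(3) i2 decks(4)[THEN Ti(3)]]
        set_integral_Un[OF dj(2) i1 decks(3)[THEN Ti(3)]]
        set_integral_Un[OF dj(1) decks(1)[THEN Ti(3)] decks(2)[THEN Ti(3)]]
      by (simp only: decks[THEN Ti(2)])
  qed
  also have "(LINT a:Reg B|lborel. L a * legendre_density t a) = pot x 1"
    by (subst LINT_finite_compl) (auto simp: pot_def L_def finite_compl_Reg B(1))
  finally show ?thesis .
qed

section \<open>The homogeneous lift and its escape rate\<close>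

lemma Fmap_affine: "Fmap t 1 (w * x, w) = (w ^ 4 * P x, w ^ 4 * Q x)"
  unfolding Fmap_def P_def Q_def by (simp add: Let_def) algebra

lemma Fmap_nonzero: "v \<noteq> (0, 0) \<Longrightarrow> Fmap t 1 v \<noteq> (0, 0)"
proof (cases "snd v = 0")
  case True
  moreover assume "v \<noteq> (0, 0)"
  ultimately show ?thesis by (auto simp: Fmap_def Let_def prod_eq_iff)
next
  case False
  then have "v = (snd v * (fst v / snd v), snd v)" by (simp add: prod_eq_iff)
  then have "Fmap t 1 v = (snd v ^ 4 * P (fst v / snd v), snd v ^ 4 * Q (fst v / snd v))"
    using Fmap_affine by metis
  then show ?thesis using False P_nonzero by auto
qed

lemma pot_functional_equation:
  assumes v: "v \<noteq> (0, 0)"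
  shows "pot (fst (Fmap t 1 v)) (snd (Fmap t 1 v)) = 4 * pot (fst v) (snd v)"
proof (cases "snd v = 0")
  \<comment> \<open>This is the point at infinity, fixed by \<open>f\<close>; the potential there is
    a multiple of a logarithm.\<close>
  case True
  then have z: "fst v \<noteq> 0" using v by (auto simp: prod_eq_iff)
  have "Fmap t 1 v = (fst v ^ 4, 0)" using True by (simp add: Fmap_def Let_def)
  moreover have "pot c 0 = ln (cmod c) * mass" for c by (simp add: pot_def mass_def)
  ultimately show ?thesis using True z by (simp add: norm_power ln_realpow)
next
  case False
  define x w where "x = fst v / snd v" "w = snd v"
  have w: "w \<noteq> 0" using False by (simp add: x_w_def)
  have v: "v = (w * x, w)" using False by (simp add: x_w_def prod_eq_iff)
  have "pot (w ^ 4 * P x) (w ^ 4 * Q x) = ln (cmod (w ^ 4)) * mass + pot (P x) (Q x)"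
    using w P_nonzero[of x] by (intro pot_scale) auto
  also have "\<dots> = 4 * (ln (cmod w) * mass + pot x 1)"
    using w by (simp add: pot_functional_equation_affine norm_power ln_realpow)
  also have "ln (cmod w) * mass + pot x 1 = pot (w * x) (w * 1)"
    using w by (intro pot_scale[symmetric]) auto
  finally show ?thesis by (simp add: v Fmap_affine)
qed

text \<open>Along the orbit \<open>pot\<close> grows by exactly 4 at each step while staying within
  \<open>C\<close> of \<open>mass\<close> times the log norm, so the error at step \<open>k\<close>
  is at most \<open>C / (mass * 4^k)\<close>.\<close>

lemma escape_rate:
  assumes v0: "v 0 \<noteq> (0, 0)" and step: "\<And>k. v (Suc k) = Fmap t 1 (v k)"
  shows "(\<lambda>k. ln (max (cmod (fst (v k))) (cmod (snd (v k)))) / 4 ^ k) \<longlonglongrightarrow> pot (fst (v 0)) (snd (v 0)) / mass"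
proof -
  obtain C where C: "\<And>z w. (z, w) \<noteq> (0, 0) \<Longrightarrow> \<bar>pot z w - ln (max (cmod z) (cmod w)) * mass\<bar> \<le> C"
    using pot_bound by metis
  have vk: "v k \<noteq> (0, 0)" for k
    by (induction k) (use v0 step Fmap_nonzero in auto)
  have potk: "pot (fst (v k)) (snd (v k)) = 4 ^ k * pot (fst (v 0)) (snd (v 0))" for k
    by (induction k) (simp_all add: step pot_functional_equation vk)
  define l where "l = (\<lambda>k. ln (max (cmod (fst (v k))) (cmod (snd (v k)))))"
  define p where "p = pot (fst (v 0)) (snd (v 0))"
  have "\<bar>l k / 4 ^ k - p / mass\<bar> \<le> (C / mass) * (1/4) ^ k" for k
  proof -
    have "\<bar>4 ^ k * p - l k * mass\<bar> \<le> C"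
      using C[of "fst (v k)" "snd (v k)"] vk[of k] potk[of k] by (simp add: l_def p_def)
    then have "\<bar>4 ^ k * p - l k * mass\<bar> / (mass * 4 ^ k) \<le> C / (mass * 4 ^ k)"
      using mass_pos by (intro divide_right_mono) auto
    moreover have "\<bar>4 ^ k * p - l k * mass\<bar> / (mass * 4 ^ k) = \<bar>(4 ^ k * p - l k * mass) / (mass * 4 ^ k)\<bar>"
      using mass_pos by (simp add: abs_mult)
    moreover have "(4 ^ k * p - l k * mass) / (mass * 4 ^ k) = p / mass - l k / 4 ^ k"
      using mass_pos by (simp add: field_simps)
    ultimately show ?thesis by (simp add: abs_minus_commute power_divide)
  qed
  moreover have "(\<lambda>k. (C / mass) * (1/4) ^ k) \<longlonglongrightarrow> 0"
    by (rule tendsto_mult_right_zero, rule LIMSEQ_power_zero) simp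
  ultimately have "(\<lambda>k. l k / 4 ^ k - p / mass) \<longlonglongrightarrow> 0"
    by (intro Lim_null_comparison[of "\<lambda>k. l k / 4 ^ k - p / mass" "\<lambda>k. (C / mass) * (1/4) ^ k"] always_eventually)
       (simp_all only: real_norm_def, blast)
  then show ?thesis unfolding l_def p_def by (rule LIM_zero_cancel)
qed

end

section \<open>Evaluation of homogeneous polynomials\<close>

text \<open>Under this bound \<open>hev\<close> is the value of the homogenisation; coefficients
  above degree \<open>fst R\<close> would be dropped.\<close>

definition hwf :: "hpoly \<Rightarrow> bool" where
  "hwf R \<longleftrightarrow> degree (snd R) \<le> fst R"

lemma hev_eq_poly:
  assumes "hwf R" "t2 \<noteq> 0"
  shows "hev R t1 t2 = t2 ^ fst R * poly (snd R) (t1 / t2)"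
proof -
  have p: "poly (snd R) (t1 / t2) = (\<Sum>i\<le>fst R. coeff (snd R) i * (t1 / t2) ^ i)"
    unfolding poly_altdef using assms(1)
    by (intro sum.mono_neutral_left) (auto simp: hwf_def coeff_eq_0)
  have "t2 ^ fst R * (coeff (snd R) i * (t1 / t2) ^ i) = coeff (snd R) i * t1 ^ i * t2 ^ (fst R - i)"
    if "i \<le> fst R" for i
    using assms(2) power_add[of t2 i "fst R - i"] that by (simp add: power_divide)
  then show ?thesis
    unfolding hev_def p sum_distrib_left by (intro sum.cong[OF refl]) (simp only: atMost_iff)
qed

lemma hwf_hmul: "hwf R \<Longrightarrow> hwf S \<Longrightarrow> hwf (hmul R S)"
  unfolding hwf_def hmul_def by (auto intro: order_trans[OF degree_mult_le])

lemma hwf_hsub: "hwf R \<Longrightarrow> hwf S \<Longrightarrow> fst R = fst S \<Longrightarrow> hwf (hsub R S)"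
  unfolding hwf_def hsub_def by (auto intro: degree_diff_le)

lemma hwf_hsmult: "hwf R \<Longrightarrow> hwf (hsmult c R)"
  unfolding hwf_def hsmult_def by (auto intro: order_trans[OF degree_smult_le])

lemma hwf_hT: "hwf hT1" "hwf hT2"
  by (simp_all add: hwf_def hT1_def hT2_def)

lemma hev_hmul: "hwf R \<Longrightarrow> hwf S \<Longrightarrow> t2 \<noteq> 0 \<Longrightarrow> hev (hmul R S) t1 t2 = hev R t1 t2 * hev S t1 t2"
  by (simp add: hev_eq_poly hwf_hmul) (simp add: hmul_def power_add)

lemma hev_hsub:
  "hwf R \<Longrightarrow> hwf S \<Longrightarrow> fst R = fst S \<Longrightarrow> t2 \<noteq> 0 \<Longrightarrow> hev (hsub R S) t1 t2 = hev R t1 t2 - hev S t1 t2"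
  by (simp add: hev_eq_poly hwf_hsub) (simp add: hsub_def algebra_simps)

lemma hev_hsmult: "hev (hsmult c R) t1 t2 = c * hev R t1 t2"
  by (simp add: hev_def hsmult_def sum_distrib_left mult.assoc)

lemma hev_hT: "t2 \<noteq> 0 \<Longrightarrow> hev hT1 t1 t2 = t1" "t2 \<noteq> 0 \<Longrightarrow> hev hT2 t1 t2 = t2"
  by (simp_all add: hev_eq_poly hwf_hT) (simp_all add: hT1_def hT2_def)

text \<open>Links the formal map on polynomials with the map on values. Equal degrees keep the
  differences homogeneous.\<close>

lemma FmapH_eval:
  assumes R: "hwf R" "hwf S" "fst R = fst S" and t2: "t2 \<noteq> 0"
  shows "(hev (fst (FmapH (R, S))) t1 t2, hev (snd (FmapH (R, S))) t1 t2)
       = Fmap t1 t2 (hev R t1 t2, hev S t1 t2)"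
    and "hwf (fst (FmapH (R, S)))" "hwf (snd (FmapH (R, S)))"
    and "fst (fst (FmapH (R, S))) = fst (snd (FmapH (R, S)))"
proof -
  note wf = hwf_hmul hwf_hsub hwf_hsmult hwf_hT R(1,2)
  have deg: "fst (hmul hT1 (hmul S S)) = fst (hmul hT2 (hmul R R))"
    "fst (hmul hT1 S) = fst (hmul hT2 R)"
    using R(3) by (simp_all add: hmul_def hT1_def hT2_def)
  note wf' = wf deg R(3)[symmetric]
  show "(hev (fst (FmapH (R, S))) t1 t2, hev (snd (FmapH (R, S))) t1 t2)
       = Fmap t1 t2 (hev R t1 t2, hev S t1 t2)"
    unfolding FmapH_def Fmap_def hsq_def Let_def
    by (simp add: hev_hmul hev_hsub hev_hsmult hev_hT wf' t2 power2_eq_square mult.assoc)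
  show "hwf (fst (FmapH (R, S)))" "hwf (snd (FmapH (R, S)))"
    unfolding FmapH_def hsq_def Let_def by (simp_all add: wf')
  show "fst (fst (FmapH (R, S))) = fst (snd (FmapH (R, S)))"
    using R(3) by (simp add: FmapH_def hsq_def Let_def hmul_def hsub_def hsmult_def hT1_def hT2_def)
qed

section \<open>Division by the homogeneous gcd\<close>

lemma hgcd_commute: "fst R = fst S \<Longrightarrow> hgcd R S = hgcd S R"
  by (simp add: hgcd_def gcd.commute min.commute)

text \<open>Ensures that the subtraction of degrees in \<open>hdiv\<close> is not truncated at
  0.\<close>

lemma hgcd_le:
  assumes R: "hwf R" "hwf S" "fst R = fst S" and nz: "snd R \<noteq> 0 \<or> snd S \<noteq> 0"
  shows "hwf (hgcd R S)" "fst (hgcd R S) \<le> fst R"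
    "hwf (hdiv R (hgcd R S))"
proof -
  define g where "g = gcd (snd R) (snd S)"
  define k where "k = min (fst R - degree (snd R)) (fst S - degree (snd S))"
  have G: "hgcd R S = (k + degree g, g)" by (simp add: hgcd_def g_def k_def Let_def)
  have g: "g \<noteq> 0" "g dvd snd R" "g dvd snd S" using nz by (auto simp: g_def)
  show "hwf (hgcd R S)" by (simp add: G hwf_def)
  have dR: "degree g \<le> degree (snd R)" if "snd R \<noteq> 0" using dvd_imp_degree_le[OF g(2) that] .
  have dS: "degree g \<le> degree (snd S)" if "snd S \<noteq> 0" using dvd_imp_degree_le[OF g(3) that] .
  \<comment> \<open>If one polynomial is zero, its degree says nothing about the gcd and the bound
    comes from the other.\<close>
  show "fst (hgcd R S) \<le> fst R"
    using nz dR dS R by (auto simp: G k_def hwf_def)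
  show "hwf (hdiv R (hgcd R S))"
  proof (cases "snd R = 0")
    case False
    obtain q where q: "snd R = g * q" using g(2) by (auto simp: dvd_def)
    then have "degree (snd R) = degree g + degree q" using False by (simp add: degree_mult_eq)
    then show ?thesis using g(1) R(1) by (auto simp: G hwf_def hdiv_def q k_def)
  qed (simp add: G hwf_def hdiv_def)
qed

lemma hev_hdiv_hgcd:
  assumes R: "hwf R" "hwf S" "fst R = fst S" and nz: "snd R \<noteq> 0 \<or> snd S \<noteq> 0" and t2: "t2 \<noteq> 0"
  shows "hev R t1 t2 = hev (hgcd R S) t1 t2 * hev (hdiv R (hgcd R S)) t1 t2"
proof -
  let ?G = "hgcd R S"
  note le = hgcd_le[OF R nz]
  have "snd ?G dvd snd R" by (simp add: hgcd_def Let_def)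
  then have "snd R = snd ?G * (snd R div snd ?G)" by simp
  then have "poly (snd R) (t1 / t2) = poly (snd ?G) (t1 / t2) * poly (snd R div snd ?G) (t1 / t2)"
    by (metis poly_mult)
  moreover have "t2 ^ fst R = t2 ^ fst ?G * t2 ^ (fst R - fst ?G)"
    using le(2) by (simp flip: power_add)
  ultimately show ?thesis
    by (simp add: hev_eq_poly le R(1) t2) (simp add: hdiv_def)
qed

section \<open>From the lift \<open>C\<close> to the formula\<close>

lemma hom_lift_nonzero:
  assumes lift: "is_hom_lift c1 c2 n" and t2: "t2 \<noteq> 0"
  shows "(hev (n, c1) t1 t2, hev (n, c2) t1 t2) \<noteq> (0, 0)" "hwf (n, c1)" "hwf (n, c2)"
proof -
  show wf: "hwf (n, c1)" "hwf (n, c2)" using lift by (auto simp: is_hom_lift_def hwf_def)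
  \<comment> \<open>A common zero would give a common linear factor, against coprimality.\<close>
  have "\<not> (poly c1 (t1 / t2) = 0 \<and> poly c2 (t1 / t2) = 0)"
  proof
    assume "poly c1 (t1 / t2) = 0 \<and> poly c2 (t1 / t2) = 0"
    then have "[:- (t1 / t2), 1:] dvd c1" "[:- (t1 / t2), 1:] dvd c2"
      by (simp_all only: poly_eq_0_iff_dvd)
    then have "is_unit [:- (t1 / t2), 1:]"
      using lift by (auto simp: is_hom_lift_def dest: coprime_common_divisor)
    then show False by (simp add: is_unit_iff_degree)
  qed
  then show "(hev (n, c1) t1 t2, hev (n, c2) t1 t2) \<noteq> (0, 0)"
    using t2 by (simp add: hev_eq_poly wf)
qed

lemma degFseq_eq: "degFseq c1 c2 n k = 4 ^ k * degF1 c1 c2 n"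
  by (induction k) auto

text \<open>Both coordinates are quadratic in \<open>(t1, t2)\<close>. The factor
  \<open>t2^2\<close> is the one divided out in \<open>Fseq\<close>, which thus iterates the map at
  parameter \<open>t1 / t2\<close>.\<close>

lemma Fmap_scale:
  assumes "t2 \<noteq> 0"
  shows "Fmap t1 t2 v = (t2\<^sup>2 * fst (Fmap (t1 / t2) 1 v), t2\<^sup>2 * snd (Fmap (t1 / t2) 1 v))"
proof -
  have "t1 * w\<^sup>2 - t2 * z\<^sup>2 = t2 * ((t1 / t2) * w\<^sup>2 - z\<^sup>2)" "t1 * w - t2 * z = t2 * ((t1 / t2) * w - z)" for z w
    using assms by (simp_all add: right_diff_distrib)
  then show ?thesis
    by (simp add: Fmap_def Let_def power_mult_distrib) (simp add: power2_eq_square mult_ac)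
qed

theorem theorem1p8:
  fixes c1 c2 :: "complex poly" and n :: nat and t1 t2 :: complex
  assumes lift: "is_hom_lift c1 c2 n"
    and c_ne0: "c1 \<noteq> 0"
    and c_ne1: "c1 \<noteq> c2"
    and c_net: "c1 \<noteq> [:0, 1:] * c2"
    and t2: "t2 \<noteq> 0"
    and t: "t1 / t2 \<notin> {0, 1}"
  shows "(\<lambda>k. G_approx c1 c2 n k t1 t2) \<longlonglongrightarrow>
     2 / real (degF1 c1 c2 n) *
        (cmod t2 * Dfun (t1 / t2) *
           (LINT \<zeta>|lborel. ln (cmod (hev (n, c1) t1 t2 - hev (n, c2) t1 t2 * \<zeta>))
                            / cmod (\<zeta> * (\<zeta> - 1) * (t2 * \<zeta> - t1)))
         + ln (cmod t2))
     - 1 / real (degF1 c1 c2 n) * ln (cmod (hev (gcdFC c1 c2 n) t1 t2))"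
proof -
  define \<tau> where "\<tau> = t1 / t2"
  interpret legendre \<tau> using t by unfold_locales (auto simp: \<tau>_def)
  define C where "C = (hev (n, c1) t1 t2, hev (n, c2) t1 t2)"
  define A where "A = fst (FC c1 c2 n)"
  define B where "B = snd (FC c1 c2 n)"
  define g where "g = hev (gcdFC c1 c2 n) t1 t2"
  define d where "d = real (degF1 c1 c2 n)"
  define v where "v = (\<lambda>k. Fseq c1 c2 n k t1 t2)"
  note C = hom_lift_nonzero[OF lift t2]
  note F = FmapH_eval[OF C(2,3) _ t2, simplified, folded FC_def, folded A_def B_def]
  have FC: "(hev A t1 t2, hev B t1 t2) = (t2\<^sup>2 * fst (Fmap \<tau> 1 C), t2\<^sup>2 * snd (Fmap \<tau> 1 C))"
    using F(1)[of t1] Fmap_scale[OF t2, of t1 C] by (simp add: C_def \<tau>_def)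
  have C0: "C \<noteq> (0, 0)" using C(1)[of t1] by (simp add: C_def)
  have FC0: "Fmap \<tau> 1 C \<noteq> (0, 0)" using Fmap_nonzero[OF C0] .
  have nz: "snd A \<noteq> 0 \<or> snd B \<noteq> 0"
  proof (rule ccontr)
    assume "\<not> ?thesis"
    then have "hev A t1 t2 = 0" "hev B t1 t2 = 0" by (simp_all add: hev_def)
    then show False using FC FC0 t2 by (simp add: prod_eq_iff)
  qed
  have G: "gcdFC c1 c2 n = hgcd A B" "gcdFC c1 c2 n = hgcd B A"
    using hgcd_commute[OF F(4)] by (simp_all add: gcdFC_def A_def B_def)
  \<comment> \<open>The gcd is written with exchanged arguments in the second coordinate, so that
    one division lemma serves both.\<close>
  have v0: "v 0 = (hev (hdiv A (hgcd A B)) t1 t2, hev (hdiv B (hgcd B A)) t1 t2)"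
    unfolding v_def by (simp add: F1_def A_def[symmetric] B_def[symmetric]) (metis G)
  have gv: "g * fst (v 0) = t2\<^sup>2 * fst (Fmap \<tau> 1 C)" "g * snd (v 0) = t2\<^sup>2 * snd (Fmap \<tau> 1 C)"
    using FC hev_hdiv_hgcd[OF F(2,3,4) nz t2, of t1]
      hev_hdiv_hgcd[OF F(3,2) F(4)[symmetric] _ t2, of t1] nz
    by (auto simp: v0 g_def simp flip: G)
  have g0: "g \<noteq> 0" and v00: "v 0 \<noteq> (0, 0)"
    using gv FC0 t2 by (auto simp: prod_eq_iff)
  have step: "v (Suc k) = Fmap \<tau> 1 (v k)" for k
    unfolding v_def using t2 Fmap_scale[OF t2, of t1 "Fseq c1 c2 n k t1 t2"]
    by (simp add: Let_def \<tau>_def)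
  \<comment> \<open>The map at parameter \<open>\<tau>\<close> sends \<open>C\<close> to
    \<open>g / t2^2\<close> times \<open>v 0\<close>; scaling the potential by this number produces
    the terms in \<open>t2\<close> and in the gcd.\<close>
  have "4 * pot (fst C) (snd C) = pot (fst (Fmap \<tau> 1 C)) (snd (Fmap \<tau> 1 C))"
    using pot_functional_equation[OF C0] by simp
  also have "\<dots> = pot ((g / t2\<^sup>2) * fst (v 0)) ((g / t2\<^sup>2) * snd (v 0))"
    using gv t2 by simp
  also have "\<dots> = ln (cmod (g / t2\<^sup>2)) * mass + pot (fst (v 0)) (snd (v 0))"
    using g0 t2 v00 by (intro pot_scale) (auto simp: prod_eq_iff)
  also have "ln (cmod (g / t2\<^sup>2)) = ln (cmod g) - 2 * ln (cmod t2)"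
    using g0 t2 by (simp add: norm_divide norm_power ln_div ln_realpow)
  finally have "pot (fst (v 0)) (snd (v 0))
      = 4 * pot (fst C) (snd C) + (2 * ln (cmod t2) - ln (cmod g)) * mass"
    by (simp only: left_diff_distrib)
  then have pot0: "pot (fst (v 0)) (snd (v 0)) / mass
      = 4 * pot (fst C) (snd C) / mass + 2 * ln (cmod t2) - ln (cmod g)"
    using mass_pos by (simp add: add_divide_distrib)
  have "(\<lambda>k. ln (max (cmod (fst (v k))) (cmod (snd (v k)))) / 4 ^ k / d)
      \<longlonglongrightarrow> pot (fst (v 0)) (snd (v 0)) / mass / d"
    using tendsto_mult_right[OF escape_rate[OF v00 step], of "1 / d"] by simp
  also have "(\<lambda>k. ln (max (cmod (fst (v k))) (cmod (snd (v k)))) / 4 ^ k / d) = (\<lambda>k. G_approx c1 c2 n k t1 t2)"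
    by (simp add: G_approx_def v_def degFseq_eq d_def)
  finally have lim: "(\<lambda>k. G_approx c1 c2 n k t1 t2)
      \<longlonglongrightarrow> (4 * pot (fst C) (snd C) / mass + 2 * ln (cmod t2) - ln (cmod g)) / d"
    unfolding pot0 .
  have LINT: "(LINT \<zeta>|lborel. ln (cmod (hev (n, c1) t1 t2 - hev (n, c2) t1 t2 * \<zeta>))
      / cmod (\<zeta> * (\<zeta> - 1) * (t2 * \<zeta> - t1))) = pot (fst C) (snd C) / cmod t2"
  proof -
    \<comment> \<open>The homogeneous denominator exceeds the affine one by the factor
      \<open>|t2|\<close>, which cancels against the \<open>|t2|\<close> in front of the
      integral.\<close>
    have "t2 * \<zeta> - t1 = t2 * (\<zeta> - \<tau>)" for \<zeta> using t2 by (simp add: \<tau>_def right_diff_distrib)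
    then have "ln (cmod (hev (n, c1) t1 t2 - hev (n, c2) t1 t2 * \<zeta>)) / cmod (\<zeta> * (\<zeta> - 1) * (t2 * \<zeta> - t1))
       = ln (cmod (fst C - snd C * \<zeta>)) * legendre_density \<tau> \<zeta> / cmod t2" for \<zeta>
      by (simp add: C_def legendre_density_def norm_mult)
    then show ?thesis by (simp add: pot_def)
  qed
  \<comment> \<open>The factors \<open>|\<tau> (\<tau> - 1)|\<close> in \<open>Dfun\<close> and
    \<open>rhoLambda\<close> cancel and leave 4/2.\<close>
  have D: "Dfun (t1 / t2) = 2 / mass"
  proof -
    have "mass = (LINT z|lborel. 1 / cmod (z * (z - 1) * (z - \<tau>)))"
      by (simp add: mass_def legendre_density_def)
    then have "Dfun \<tau> = 4 * cmod (\<tau> * (\<tau> - 1)) * (1 / (2 * cmod (\<tau> * (\<tau> - 1)) * mass))"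
      unfolding Dfun_def rhoLambda_def by simp
    then show ?thesis using t0 t1 by (simp flip: \<tau>_def)
  qed
  have eq: "2 / d * (cmod t2 * (2 / mass) * (pot (fst C) (snd C) / cmod t2) + ln (cmod t2)) - 1 / d * ln (cmod g)
     = (4 * pot (fst C) (snd C) / mass + 2 * ln (cmod t2) - ln (cmod g)) / d"
    using t2 by (simp add: add_divide_distrib diff_divide_distrib distrib_left)
  show ?thesis
    unfolding LINT D d_def[symmetric] g_def[symmetric] eq by (rule lim)
qed

end
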